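(* Fix $\theta$ and the total uncertainty $\sigma^2=\sigma_\theta^2+\sigma_\epsilon^2$. Let $\hat r^*$, $\hat r^*_{SC}$ and $\hat r^*_{RC}$ be the optimal, the optimal spread-constrained and the optimal rate-constrained reward programs (defined in the context), and let $\mathbb{E}_v[\Pi(p,\hat r(v))]$ denote the expected profit of a reward program with its associated cutoff. Then: (i) if $\frac{\sigma_\epsilon}{\sigma_\theta}\ge\frac{p}{\sqrt{2\pi}\,\sigma}$, then $\hat r^*_{SC}$ is optimal, i.e. it is also the solution of problem (P); (ii) $\hat r^*_{RC}$ is asymptotically optimal, in the sense that $$\lim_{\sigma_\epsilon\to0}\frac{\mathbb{E}_v[\Pi(p,\hat r^*_{RC}(v))]}{\mathbb{E}_v[\Pi(p,\hat r^*(v))]}=1 .$$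
   Context: Parameters: $\theta\in\mathbb{R}$, $\sigma_\theta>0$, $\sigma_\epsilon>0$, $\sigma=\sqrt{\sigma_\theta^2+\sigma_\epsilon^2}$. $\Phi$ and $\phi$ are the CDF and PDF of the standard normal distribution. The quality $v$ of a product has prior $v\sim N(\theta,\sigma_\theta^2)$; $\mathbb{E}_v$ is expectation under this prior. Consumers have valuations $v_i=v+\epsilon_i$ with $\epsilon_i\sim N(0,\sigma_\epsilon^2)$ independent of $v$, so that $v\,|\,v_i\sim N(\tau v_i+(1-\tau)\theta,\sigma_v^2)$ with $\tau=\frac{\sigma_\theta^2}{\sigma_\epsilon^2+\sigma_\theta^2}$ and $\sigma_v=\frac{\sigma_\epsilon\sigma_\theta}{\sqrt{\sigma_\epsilon^2+\sigma_\theta^2}}$; $\mathbb{E}_{v|v_i}$ is expectation under this posterior. For $c\in\mathbb{R}$ let $\mu_c=\tau c+(1-\tau)\theta$. Standing assumption: the market price $p>0$ maximizes $p\mapsto p\,\Phi(\frac{\theta-p}{\sigma})$, i.e. it is the unique solution of $\frac{p}{\sigma}=\Phi(\frac{\theta-p}{\sigma})/\phi(\frac{\theta-p}{\sigma})$ (so $p$ depends only on $\theta,\sigma$). A reward program is a measurable $\hat r:\mathbb{R}\to[0,p]$ (rebate per buyer at quality $v$), with a cutoff $c\in\mathbb{R}$ (consumers buy iff $v_i>c$). Its expected profit is $\mathbb{E}_v[\Pi(p,\hat r(v))]=\mathbb{E}_v[(p-\hat r(v))\Phi(\frac{v-c}{\sigma_\epsilon})]$. Problem (P), with solution $\hat r^*$: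 maximize the expected profit over $\hat r\in L^\infty(\mathbb{R};[0,p])$ and $c\in\mathbb{R}$ subject to $\mathbb{E}_{v|v_i}[\hat r(v)]+v_i-p\ge0$ for all $v_i\ge c$ and $\mathbb{E}_{v|v_i}[\hat r(v)]+v_i-p\le0$ for all $v_i\le c$. $\hat r^*_{SC}$: the solution of maximizing the expected profit over $\hat r:\mathbb{R}\to[0,p]$, $c\in\mathbb{R}$ subject to $r_{\max}-r_{\min}\le\sqrt{2\pi}\frac{\sigma_\epsilon\sigma}{\sigma_\theta}$ (where $r_{\max},r_{\min}$ are the maximum and minimum of $\hat r$) and $c+\mathbb{E}_{v|v_i=c}[\hat r(v)]=p$. It is given by $\hat r^*_{SC}(v)=r_M\mathbf{1}\{v\le v_c\}$, $r_M=\min(p,\sqrt{2\pi}\frac{\sigma_\epsilon\sigma}{\sigma_\theta})$, with $(c,v_c)$ solving $p=c+r_M\Phi(\frac{v_c-\mu_c}{\sigma_v})$ and $\sigma_\epsilon\Phi(\frac{v_c-c}{\sigma_\epsilon})/\phi(\frac{v_c-c}{\sigma_\epsilon})=c/\big(1-\frac{\tau r_M}{\sigma_v}\phi(\frac{v_c-\mu_c}{\sigma_v})\big)$. $\hat r^*_{RC}$: the solution of maximizing the expected profit over $c\in\mathbb{R}$ and continuous, piecewise continuously differentiable $\hat r:\mathbb{R}\to[0,p]$ with $|\frac{d}{dv}\hat r(v)|\le\frac1\tau$, subject to $c+\mathbb{E}_{v|v_i=c}[\hat r(v)]=p$. It equals $p$ for $v<v_L$, $p-\frac1\tau(v-v_L)$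 for $v_L\le v<v_H$, and $0$ for $v\ge v_H$, with $(c,v_L,v_H)$ solving: $v_H-v_L=\tau p$; $p=c+\frac{\sigma_v}{\tau}\big(y_H\Phi(y_H)-y_L\Phi(y_L)+\phi(y_H)-\phi(y_L)\big)$; and $$\frac{\int_{v_L}^{v_H}\Phi(\frac{w-c}{\sigma_\epsilon})\frac{1}{\sigma_\theta}\phi(\frac{\theta-w}{\sigma_\theta})dw}{\Phi(y_H)-\Phi(y_L)}=\frac{c\,\frac1\sigma\phi(\frac{\theta-c}{\sigma})}{1+\Phi(y_L)-\Phi(y_H)},$$ where $y_H=\frac{v_H-\mu_c}{\sigma_v}$, $y_L=\frac{v_L-\mu_c}{\sigma_v}$. *)

theory Defs
  imports "HOL-Probability.Probability"
begin

text \<open>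
  \<open>\<Phi>\<close> is the standard normal distribution function. Throughout, \<open>\<sigma>\<theta>\<close> and \<open>\<sigma>\<epsilon>\<close> are the standard
  deviations of the quality \<open>v\<close> (with mean \<open>\<theta>\<close>) and of the idiosyncratic noise in \<open>v\<^sub>i = v + \<epsilon>\<^sub>i\<close>.
\<close>

definition Phi :: "real \<Rightarrow> real" (\<open>\<Phi>\<close>)
  where "\<Phi> x = cdf std_normal_distribution x"

definition normal_distribution :: "real \<Rightarrow> real \<Rightarrow> real measure"
  where "normal_distribution m s = density lborel (normal_density m s)"

definition total_sd :: "real \<Rightarrow> real \<Rightarrow> real"
  where "total_sd \<sigma>\<theta> \<sigma>\<epsilon> = sqrt (\<sigma>\<theta>\<^sup>2 + \<sigma>\<epsilon>\<^sup>2)"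

definition posterior_weight :: "real \<Rightarrow> real \<Rightarrow> real" (\<open>\<tau>\<close>)
  where "\<tau> \<sigma>\<theta> \<sigma>\<epsilon> = \<sigma>\<theta>\<^sup>2 / (\<sigma>\<epsilon>\<^sup>2 + \<sigma>\<theta>\<^sup>2)"

definition posterior_sd :: "real \<Rightarrow> real \<Rightarrow> real"
  where "posterior_sd \<sigma>\<theta> \<sigma>\<epsilon> = \<sigma>\<epsilon> * \<sigma>\<theta> / sqrt (\<sigma>\<epsilon>\<^sup>2 + \<sigma>\<theta>\<^sup>2)"

text \<open>The law of \<open>v\<close> conditional on \<open>v\<^sub>i = x\<close>.\<close>

definition posterior :: "real \<Rightarrow> real \<Rightarrow> real \<Rightarrow> real \<Rightarrow> real measure"
  where "posterior \<theta> \<sigma>\<theta> \<sigma>\<epsilon> x =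
    normal_distribution (\<tau> \<sigma>\<theta> \<sigma>\<epsilon> * x + (1 - \<tau> \<sigma>\<theta> \<sigma>\<epsilon>) * \<theta>) (posterior_sd \<sigma>\<theta> \<sigma>\<epsilon>)"

definition market_price :: "real \<Rightarrow> real \<Rightarrow> real \<Rightarrow> bool"
  where "market_price \<theta> \<sigma> p \<longleftrightarrow> is_arg_max (\<lambda>q. q * \<Phi> ((\<theta> - q) / \<sigma>)) (\<lambda>q. q > 0) p"

text \<open>
  Borel functions with values in \<open>[0, p]\<close> everywhere: every element of \<open>L\<^sup>\<infinity>(\<real>; [0, p])\<close> has such a
  representative, and the integrals below do not depend on its choice.
\<close>

definition reward_program :: "real \<Rightarrow> (real \<Rightarrow> real) \<Rightarrow> bool"
  where "reward_program p r \<longleftrightarrow> r \<in> borel_measurable borel \<and> (\<forall>v. 0 \<le> r v \<and> r v \<le> p)"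

definition expected_profit ::
    "real \<Rightarrow> real \<Rightarrow> real \<Rightarrow> real \<Rightarrow> (real \<Rightarrow> real) \<Rightarrow> real \<Rightarrow> real"
  where "expected_profit \<theta> \<sigma>\<theta> \<sigma>\<epsilon> p r c =
    (\<integral>v. (p - r v) * \<Phi> ((v - c) / \<sigma>\<epsilon>) \<partial>normal_distribution \<theta> \<sigma>\<theta>)"

definition posterior_reward ::
    "real \<Rightarrow> real \<Rightarrow> real \<Rightarrow> (real \<Rightarrow> real) \<Rightarrow> real \<Rightarrow> real"
  where "posterior_reward \<theta> \<sigma>\<theta> \<sigma>\<epsilon> r x = (\<integral>v. r v \<partial>posterior \<theta> \<sigma>\<theta> \<sigma>\<epsilon> x)"

definition feasible ::
    "real \<Rightarrow> real \<Rightarrow> real \<Rightarrow> real \<Rightarrow> (real \<Rightarrow> real) \<Rightarrow> real \<Rightarrow> bool"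
  where "feasible \<theta> \<sigma>\<theta> \<sigma>\<epsilon> p r c \<longleftrightarrow>
    reward_program p r \<and>
    (\<forall>x\<ge>c. posterior_reward \<theta> \<sigma>\<theta> \<sigma>\<epsilon> r x + x - p \<ge> 0) \<and>
    (\<forall>x\<le>c. posterior_reward \<theta> \<sigma>\<theta> \<sigma>\<epsilon> r x + x - p \<le> 0)"

definition feasible_SC ::
    "real \<Rightarrow> real \<Rightarrow> real \<Rightarrow> real \<Rightarrow> (real \<Rightarrow> real) \<Rightarrow> real \<Rightarrow> bool"
  where "feasible_SC \<theta> \<sigma>\<theta> \<sigma>\<epsilon> p r c \<longleftrightarrow>
    reward_program p r \<and>
    (SUP v. r v) - (INF v. r v) \<le> sqrt (2 * pi) * (\<sigma>\<epsilon> * total_sd \<sigma>\<theta> \<sigma>\<epsilon> / \<sigma>\<theta>) \<and>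
    c + posterior_reward \<theta> \<sigma>\<theta> \<sigma>\<epsilon> r c = p"

definition feasible_RC ::
    "real \<Rightarrow> real \<Rightarrow> real \<Rightarrow> real \<Rightarrow> (real \<Rightarrow> real) \<Rightarrow> real \<Rightarrow> bool"
  where "feasible_RC \<theta> \<sigma>\<theta> \<sigma>\<epsilon> p r c \<longleftrightarrow>
    reward_program p r \<and>
    r piecewise_C1_differentiable_on UNIV \<and>
    (\<forall>v. r differentiable at v \<longrightarrow> \<bar>deriv r v\<bar> \<le> 1 / \<tau> \<sigma>\<theta> \<sigma>\<epsilon>) \<and>
    c + posterior_reward \<theta> \<sigma>\<theta> \<sigma>\<epsilon> r c = p"

definition optimal ::
    "real \<Rightarrow> real \<Rightarrow> real \<Rightarrow> real \<Rightarrow> (real \<Rightarrow> real) \<Rightarrow> real \<Rightarrow> bool"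
  where "optimal \<theta> \<sigma>\<theta> \<sigma>\<epsilon> p r c \<longleftrightarrow>
    is_arg_max (\<lambda>(r, c). expected_profit \<theta> \<sigma>\<theta> \<sigma>\<epsilon> p r c)
      (\<lambda>(r, c). feasible \<theta> \<sigma>\<theta> \<sigma>\<epsilon> p r c) (r, c)"

definition optimal_SC ::
    "real \<Rightarrow> real \<Rightarrow> real \<Rightarrow> real \<Rightarrow> (real \<Rightarrow> real) \<Rightarrow> real \<Rightarrow> bool"
  where "optimal_SC \<theta> \<sigma>\<theta> \<sigma>\<epsilon> p r c \<longleftrightarrow>
    is_arg_max (\<lambda>(r, c). expected_profit \<theta> \<sigma>\<theta> \<sigma>\<epsilon> p r c)
      (\<lambda>(r, c). feasible_SC \<theta> \<sigma>\<theta> \<sigma>\<epsilon> p r c) (r, c)"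

definition optimal_RC ::
    "real \<Rightarrow> real \<Rightarrow> real \<Rightarrow> real \<Rightarrow> (real \<Rightarrow> real) \<Rightarrow> real \<Rightarrow> bool"
  where "optimal_RC \<theta> \<sigma>\<theta> \<sigma>\<epsilon> p r c \<longleftrightarrow>
    is_arg_max (\<lambda>(r, c). expected_profit \<theta> \<sigma>\<theta> \<sigma>\<epsilon> p r c)
      (\<lambda>(r, c). feasible_RC \<theta> \<sigma>\<theta> \<sigma>\<epsilon> p r c) (r, c)"

end

theory Submission
  imports Defs
begin

text \<open>
  Both parts rest on the slope of \<open>x \<mapsto> x + E[r | v\<^sub>i = x]\<close>: once it is nondecreasing, the single
  equation \<open>c + E[r | v\<^sub>i = c] = p\<close> already gives the threshold constraints of problem (P).

  (i) Here the spread constraint is vacuous, and for values in \<open>[0, p]\<close> the conditional expectation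
  decreases with slope at most \<open>p \<tau> / (\<sigma>\<^sub>v sqrt (2 pi)) \<le> 1\<close>. So both problems have the same
  feasible set.

  (ii) A rate-constrained program has a conditional expectation with Lipschitz constant \<open>1\<close>, so it is
  feasible for (P). By Fubini, the profit is the mean of \<open>p - E[r | v\<^sub>i]\<close> on \<open>v\<^sub>i \<ge> c\<close>, and
  feasibility bounds this integrand by \<open>min p v\<^sub>i\<close>. Hence every profit is at most
  \<open>U = E[max 0 (min p v\<^sub>i)]\<close>, which depends only on \<open>\<theta>\<close>, \<open>\<sigma>\<close> and \<open>p\<close>. The ramp
  \<open>r v = max 0 (min p (p - v + \<delta>))\<close> is rate-constrained, and its profit differs from \<open>U\<close> by a
  quantity that vanishes with \<open>\<sigma>\<epsilon>\<close>, for a suitable \<open>\<delta>\<close> of order \<open>\<sigma>\<epsilon>\<close>.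
\<close>

section \<open>Normal distributions\<close>

lemma sets_normal_distribution [simp, measurable_cong]:
  "sets (normal_distribution m s) = sets borel"
  and space_normal_distribution [simp]: "space (normal_distribution m s) = UNIV"
  by (simp_all add: normal_distribution_def)

lemma prob_space_normal_distribution: "s > 0 \<Longrightarrow> prob_space (normal_distribution m s)"
  unfolding normal_distribution_def by (rule prob_space_normal_density)

lemma integral_normal_distribution:
  fixes f :: "real \<Rightarrow> real"
  assumes "f \<in> borel_measurable borel"
  shows "(\<integral>v. f v \<partial>normal_distribution m s) = (\<integral>v. normal_density m s v * f v \<partial>lborel)"
  unfolding normal_distribution_def using assms by (subst integral_density) auto

lemma integrable_normal_distribution_iff:
  fixes f :: "real \<Rightarrow> real"
  assumes "f \<in> borel_measurable borel"
  shows "integrable (normal_distribution m s) f \<longleftrightarrow> integrable lborel (\<lambda>v. normal_density m s v * f v)"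
  unfolding normal_distribution_def using assms by (subst integrable_density) auto

lemma integrable_normal_distribution_bounded:
  fixes f :: "real \<Rightarrow> real"
  assumes "s > 0" "f \<in> borel_measurable borel" "\<And>v. \<bar>f v\<bar> \<le> B"
  shows "integrable (normal_distribution m s) f"
proof -
  interpret prob_space "normal_distribution m s"
    by (rule prob_space_normal_distribution) fact
  show ?thesis
    using assms by (intro integrable_const_bound[where B = B]) auto
qed

text \<open>The absolute value admits negative scales: with \<open>a = - s\<close> the reflected
  standard normal variable turns an upper tail into a value of \<open>\<Phi>\<close>.\<close>

lemma normal_distribution_affine:
  assumes "a \<noteq> 0"
  shows "normal_distribution m \<bar>a\<bar> = distr std_normal_distribution borel (\<lambda>z. m + a * z)"
proof -
  interpret prob_space std_normal_distribution
    by (rule prob_space_normal_density) simp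
  have "distributed std_normal_distribution lborel (\<lambda>z. z) (normal_density 0 1)"
    unfolding distributed_def by (auto intro!: distr_id2)
  from normal_density_affine[OF this, of a m] assms
  have "distr std_normal_distribution lborel (\<lambda>z. m + a * z) = density lborel (normal_density m \<bar>a\<bar>)"
    by (simp add: distributed_def)
  moreover have "distr std_normal_distribution lborel (\<lambda>z. m + a * z)
      = distr std_normal_distribution borel (\<lambda>z. m + a * z)"
    by (rule distr_cong) auto
  ultimately show ?thesis
    by (simp add: normal_distribution_def)
qed

lemma integral_normal_distribution_std:
  fixes f :: "real \<Rightarrow> real"
  assumes "s > 0" "f \<in> borel_measurable borel"
  shows "(\<integral>v. f v \<partial>normal_distribution m s) = (\<integral>z. f (m + s * z) \<partial>std_normal_distribution)"
  using assms normal_distribution_affine[of s m] by (simp add: integral_distr)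

lemma integrable_std_normal_abs: "integrable std_normal_distribution (\<lambda>z. \<bar>z\<bar>)"
  and integral_std_normal_abs: "(\<integral>z. \<bar>z\<bar> \<partial>std_normal_distribution) = sqrt (2 / pi)"
proof -
  have *: "has_bochner_integral lborel (\<lambda>z. std_normal_density z * \<bar>z\<bar>) (sqrt (2 / pi))"
    using std_normal_moment_abs_odd[of 0] by simp
  show "integrable std_normal_distribution (\<lambda>z. \<bar>z\<bar>)"
    using integrable.intros[OF *] by (subst integrable_density) auto
  show "(\<integral>z. \<bar>z\<bar> \<partial>std_normal_distribution) = sqrt (2 / pi)"
    using has_bochner_integral_integral_eq[OF *] by (subst integral_density) auto
qed

lemma integrable_normal_abs_diff:
  assumes "s > 0"
  shows "integrable (normal_distribution m s) (\<lambda>v. \<bar>v - a\<bar>)"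
proof -
  interpret prob_space std_normal_distribution
    by (rule prob_space_normal_density) simp
  have "integrable std_normal_distribution (\<lambda>z. \<bar>m + s * z - a\<bar>)"
  proof (rule Bochner_Integration.integrable_bound)
    show "integrable std_normal_distribution (\<lambda>z. \<bar>m - a\<bar> + s * \<bar>z\<bar>)"
      using integrable_std_normal_abs by auto
    have "\<bar>m + s * z - a\<bar> \<le> \<bar>m - a\<bar> + s * \<bar>z\<bar>" for z
    proof -
      have "\<bar>s * z\<bar> = s * \<bar>z\<bar>" using assms by (simp add: abs_mult)
      then show ?thesis by linarith
    qed
    moreover have "0 \<le> \<bar>m - a\<bar> + s * \<bar>z\<bar>" for z
      using assms by simp
    ultimately show "AE z in std_normal_distribution.
        norm \<bar>m + s * z - a\<bar> \<le> norm (\<bar>m - a\<bar> + s * \<bar>z\<bar>)"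
      by simp
  qed simp
  then show ?thesis
    using normal_distribution_affine[of s m] assms by (simp add: integrable_distr_eq)
qed

text \<open>Standardize and apply the triangle inequality. The exact factor
  \<open>sqrt (2 / pi)\<close> is rounded up to 1, as only the order in \<open>s\<close> matters for
  the limit.\<close>

lemma integral_normal_abs_diff_le:
  assumes "s > 0"
  shows "(\<integral>v. \<bar>v - a\<bar> \<partial>normal_distribution m s) \<le> \<bar>m - a\<bar> + s"
proof -
  interpret prob_space std_normal_distribution
    by (rule prob_space_normal_density) simp
  have int: "integrable std_normal_distribution (\<lambda>z. \<bar>m + s * z - a\<bar>)"
    using integrable_normal_abs_diff[OF assms, of m a] normal_distribution_affine[of s m] assms
    by (simp add: integrable_distr_eq)
  have "(\<integral>v. \<bar>v - a\<bar> \<partial>normal_distribution m s) = (\<integral>z. \<bar>m + s * z - a\<bar> \<partial>std_normal_distribution)"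
    by (rule integral_normal_distribution_std) (use assms in auto)
  also have "\<dots> \<le> (\<integral>z. \<bar>m - a\<bar> + s * \<bar>z\<bar> \<partial>std_normal_distribution)"
  proof (rule integral_mono[OF int])
    show "integrable std_normal_distribution (\<lambda>z. \<bar>m - a\<bar> + s * \<bar>z\<bar>)"
      using integrable_std_normal_abs by auto
    fix z
    have "\<bar>s * z\<bar> = s * \<bar>z\<bar>" using assms by (simp add: abs_mult)
    then show "\<bar>m + s * z - a\<bar> \<le> \<bar>m - a\<bar> + s * \<bar>z\<bar>" by linarith
  qed
  also have "\<dots> = \<bar>m - a\<bar> + s * sqrt (2 / pi)"
    using integrable_std_normal_abs prob_space by (simp add: integral_std_normal_abs)
  also have "\<dots> \<le> \<bar>m - a\<bar> + s"
  proof -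
    have "sqrt (2 / pi) \<le> 1"
      using pi_gt3 by (simp add: field_simps)
    then have "s * sqrt (2 / pi) \<le> s * 1"
      using assms by (intro mult_left_mono) auto
    then show ?thesis by simp
  qed
  finally show ?thesis .
qed

text \<open>The half line is closed so that reflecting the standard normal variable yields \<open>\<Phi>\<close> exactly.\<close>

lemma Phi_eq_integral:
  assumes "s > 0"
  shows "\<Phi> ((v - c) / s) = (\<integral>x. normal_density v s x * indicator {c..} x \<partial>lborel)"
proof -
  have "(\<integral>x. normal_density v s x * indicator {c..} x \<partial>lborel)
      = (\<integral>x. indicator {c..} x \<partial>normal_distribution v s)"
    by (subst integral_normal_distribution) auto
  also have "\<dots> = measure (distr std_normal_distribution borel (\<lambda>z. v + (- s) * z)) {c..}"
    using assms normal_distribution_affine[of "- s" v] by simp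
  also have "\<dots> = measure std_normal_distribution {z. c \<le> v - s * z}"
    by (subst measure_distr) (auto intro!: arg_cong[where f = "measure _"])
  also have "{z. c \<le> v - s * z} = {..(v - c) / s}"
    using assms by (auto simp: field_simps)
  finally show ?thesis
    by (simp add: Phi_def cdf_def)
qed

section \<open>Dependence of normal expectations on the mean\<close>

lemma measure_std_normal_interval_le:
  assumes "a \<le> b"
  shows "measure std_normal_distribution {a<..b} \<le> (b - a) / sqrt (2 * pi)"
proof -
  have "measure std_normal_distribution {a<..b}
      = (\<integral>z. indicator {a<..b} z \<partial>std_normal_distribution)"
    by simp
  also have "\<dots> = (\<integral>z. std_normal_density z * indicator {a<..b} z \<partial>lborel)"
    by (subst integral_density) auto
  also have "\<dots> \<le> (\<integral>z. 1 / sqrt (2 * pi) * indicator {a<..b} z \<partial>lborel)"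
  proof (rule integral_mono)
    have "integrable lborel std_normal_density"
      by (rule integrable_normal_density) simp
    then show "integrable lborel (\<lambda>z. std_normal_density z * indicator {a<..b} z)"
      by (rule integrable_real_mult_indicator[rotated]) auto
    show "integrable lborel (\<lambda>z. 1 / sqrt (2 * pi) * indicator {a<..b} z)"
      using assms by (intro integrable_mult_right integrable_real_indicator) auto
    fix z :: real
    \<comment> \<open>The peak of the density. This is the source of the constant
      \<open>sqrt (2 * pi)\<close> in the spread constraint.\<close>
    have "std_normal_density z \<le> 1 / sqrt (2 * pi)"
      by (simp add: std_normal_density_def divide_right_mono)
    then show "std_normal_density z * indicator {a<..b} z \<le> 1 / sqrt (2 * pi) * indicator {a<..b} z"
      by (intro mult_right_mono) auto
  qed
  also have "\<dots> = (b - a) / sqrt (2 * pi)"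
    using assms by simp
  finally show ?thesis .
qed

text \<open>
  The density with the smaller mean dominates exactly to the left of the midpoint \<open>h\<close> of the means,
  so the extremal \<open>f\<close> is \<open>p\<close> times the indicator of \<open>{..h}\<close>.
\<close>

lemma integral_normal_bounded_decrease_le:
  fixes f :: "real \<Rightarrow> real"
  assumes s: "s > 0" and f: "f \<in> borel_measurable borel" "\<And>v. 0 \<le> f v \<and> f v \<le> p"
    and m: "m \<le> m'"
  shows "(\<integral>v. f v \<partial>normal_distribution m s) - (\<integral>v. f v \<partial>normal_distribution m' s)
      \<le> p * (m' - m) / (s * sqrt (2 * pi))"
proof -
  define h where "h = (m + m') / 2"
  have p: "0 \<le> p" using f(2)[of 0] by linarith
  have int: "integrable lborel (\<lambda>v. normal_density n s v * g v)"
    if "g \<in> borel_measurable borel" "\<And>v. \<bar>g v\<bar> \<le> B" for n and g :: "real \<Rightarrow> real" and B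
    using integrable_normal_distribution_bounded[OF s that] that(1)
    by (simp add: integrable_normal_distribution_iff)
  have fB: "\<bar>f v\<bar> \<le> p" for v using f(2)[of v] by simp
  have iB: "\<bar>p * indicator {..h} v\<bar> \<le> p" for v using p by (simp add: indicator_def)
  have tail: "(\<integral>v. normal_density n s v * (p * indicator {..h} v) \<partial>lborel)
      = p * measure std_normal_distribution {..(h - n) / s}" for n
  proof -
    have "measure (normal_distribution n s) {..h} = measure std_normal_distribution {z. n + s * z \<le> h}"
      using normal_distribution_affine[of s n] s
      by (simp, subst measure_distr) (auto intro!: arg_cong[where f = "measure _"])
    also have "{z. n + s * z \<le> h} = {..(h - n) / s}"
      using s by (auto simp: field_simps)
    finally show ?thesis
      by (subst integral_normal_distribution[symmetric]) auto
  qed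
  have "(\<integral>v. f v \<partial>normal_distribution m s) - (\<integral>v. f v \<partial>normal_distribution m' s)
      = (\<integral>v. normal_density m s v * f v - normal_density m' s v * f v \<partial>lborel)"
    using f by (simp add: integral_normal_distribution int[OF f(1) fB])
  also have "\<dots> \<le> (\<integral>v. normal_density m s v * (p * indicator {..h} v)
      - normal_density m' s v * (p * indicator {..h} v) \<partial>lborel)"
  proof (rule integral_mono)
    fix v
    show "normal_density m s v * f v - normal_density m' s v * f v
        \<le> normal_density m s v * (p * indicator {..h} v) - normal_density m' s v * (p * indicator {..h} v)"
    proof (cases "v \<le> h")
      case True
      \<comment> \<open>The product equals \<open>(v - m')\<^sup>2 - (v - m)\<^sup>2\<close>, whose
        sign decides which of the two densities is larger at \<open>v\<close>.\<close>
      then have "0 \<le> (m' - m) * (m + m' - 2 * v)"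
        using m by (intro mult_nonneg_nonneg) (auto simp: h_def)
      then have "(v - m)\<^sup>2 \<le> (v - m')\<^sup>2"
        by (simp add: power2_eq_square algebra_simps)
      then have "normal_density m' s v \<le> normal_density m s v"
        using s by (simp add: normal_density_def divide_right_mono)
      then have "(normal_density m s v - normal_density m' s v) * f v
          \<le> (normal_density m s v - normal_density m' s v) * p"
        using f(2)[of v] by (intro mult_left_mono) auto
      then show ?thesis using True by (simp add: algebra_simps)
    next
      case False
      then have "0 \<le> (m' - m) * (2 * v - (m + m'))"
        using m by (intro mult_nonneg_nonneg) (auto simp: h_def)
      then have "(v - m')\<^sup>2 \<le> (v - m)\<^sup>2"
        by (simp add: power2_eq_square algebra_simps)
      then have "normal_density m s v \<le> normal_density m' s v"
        using s by (simp add: normal_density_def divide_right_mono)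
      then have "normal_density m s v * f v \<le> normal_density m' s v * f v"
        using f(2)[of v] by (intro mult_right_mono) auto
      then show ?thesis using False by simp
    qed
  qed (auto intro!: Bochner_Integration.integrable_diff int f fB iB)
  also have "\<dots> = p * measure std_normal_distribution {..(h - m) / s}
      - p * measure std_normal_distribution {..(h - m') / s}"
    unfolding tail[symmetric]
    by (rule Bochner_Integration.integral_diff) (auto intro!: int iB)
  also have "\<dots> = p * measure std_normal_distribution {(h - m') / s<..(h - m) / s}"
  proof -
    interpret real_distribution std_normal_distribution
      by (rule real_dist_normal_dist)
    have ab: "(h - m') / s \<le> (h - m) / s" using m s by (simp add: divide_right_mono)
    \<comment> \<open>\<open>cdf_diff_eq\<close> wants a strict inequality, so equal endpoints are
      treated apart; there both sides are 0.\<close>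
    have "cdf std_normal_distribution ((h - m) / s) - cdf std_normal_distribution ((h - m') / s)
        = measure std_normal_distribution {(h - m') / s<..(h - m) / s}"
    proof (cases "(h - m') / s = (h - m) / s")
      case False
      then show ?thesis using ab by (intro cdf_diff_eq) linarith
    qed (simp only: diff_self greaterThanAtMost_empty[OF order_refl] measure_empty)
    then show ?thesis by (simp add: cdf_def right_diff_distrib[symmetric])
  qed
  \<comment> \<open>The interval has length \<open>(m' - m) / s\<close>, the distance of the means
    in standard units.\<close>
  also have "\<dots> \<le> p * (((h - m) / s - (h - m') / s) / sqrt (2 * pi))"
    using m s p by (intro mult_left_mono measure_std_normal_interval_le) (auto simp: divide_right_mono)
  also have "\<dots> = p * (m' - m) / (s * sqrt (2 * pi))"
    by (simp add: diff_divide_distrib[symmetric])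
  finally show ?thesis .
qed

text \<open>Coupling: both laws are images of one standard normal variable \<open>z\<close>, and the
  two arguments of \<open>f\<close> always differ by \<open>m - m'\<close>.\<close>

lemma integral_normal_lipschitz:
  fixes f :: "real \<Rightarrow> real"
  assumes s: "s > 0" and f: "f \<in> borel_measurable borel" "\<And>v. \<bar>f v\<bar> \<le> B"
    and L: "\<And>u v. \<bar>f u - f v\<bar> \<le> L * \<bar>u - v\<bar>"
  shows "\<bar>(\<integral>v. f v \<partial>normal_distribution m s) - (\<integral>v. f v \<partial>normal_distribution m' s)\<bar> \<le> L * \<bar>m - m'\<bar>"
proof -
  interpret prob_space std_normal_distribution
    by (rule prob_space_normal_density) simp
  have int: "integrable std_normal_distribution (\<lambda>z. f (n + s * z))" for n
    using f by (intro integrable_const_bound[where B = B]) auto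
  have "\<bar>(\<integral>v. f v \<partial>normal_distribution m s) - (\<integral>v. f v \<partial>normal_distribution m' s)\<bar>
      = \<bar>\<integral>z. f (m + s * z) - f (m' + s * z) \<partial>std_normal_distribution\<bar>"
    using s f by (simp add: integral_normal_distribution_std int)
  also have "\<dots> \<le> (\<integral>z. \<bar>f (m + s * z) - f (m' + s * z)\<bar> \<partial>std_normal_distribution)"
    by (rule integral_abs_bound)
  also have "\<dots> \<le> (\<integral>z. L * \<bar>m - m'\<bar> \<partial>std_normal_distribution)"
  proof (rule integral_mono)
    show "\<bar>f (m + s * z) - f (m' + s * z)\<bar> \<le> L * \<bar>m - m'\<bar>" for z
      using L[of "m + s * z" "m' + s * z"] by simp
  qed (auto intro!: int)
  also have "\<dots> = L * \<bar>m - m'\<bar>"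
    using prob_space by simp
  finally show ?thesis .
qed

text \<open>The reference point \<open>x\<close> may differ from the mean \<open>m\<close>, because
  the posterior mean given a signal is not the signal itself.\<close>

lemma abs_integral_normal_diff_le:
  fixes f :: "real \<Rightarrow> real"
  assumes s: "s > 0" and f: "f \<in> borel_measurable borel" "\<And>v. \<bar>f v\<bar> \<le> B"
    and L: "\<And>u v. \<bar>f u - f v\<bar> \<le> \<bar>u - v\<bar>"
  shows "\<bar>(\<integral>v. f v \<partial>normal_distribution m s) - f x\<bar> \<le> \<bar>m - x\<bar> + s"
proof -
  interpret prob_space "normal_distribution m s"
    by (rule prob_space_normal_distribution) fact
  have int: "integrable (normal_distribution m s) f"
    by (rule integrable_normal_distribution_bounded) fact+
  have "(\<integral>v. f v \<partial>normal_distribution m s) - f x = (\<integral>v. f v - f x \<partial>normal_distribution m s)"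
    using int prob_space by simp
  also have "\<bar>\<dots>\<bar> \<le> (\<integral>v. \<bar>f v - f x\<bar> \<partial>normal_distribution m s)"
    by (rule integral_abs_bound)
  also have "\<dots> \<le> (\<integral>v. \<bar>v - x\<bar> \<partial>normal_distribution m s)"
    by (rule integral_mono) (auto intro!: int integrable_normal_abs_diff s L)
  also have "\<dots> \<le> \<bar>m - x\<bar> + s"
    by (rule integral_normal_abs_diff_le) fact
  finally show ?thesis .
qed

section \<open>The signal and the posterior\<close>

lemma total_sd_pos: "\<sigma>\<epsilon> > 0 \<Longrightarrow> total_sd \<sigma>\<theta> \<sigma>\<epsilon> > 0"
  by (simp add: total_sd_def add_nonneg_pos)

lemma posterior_sd_pos: "\<sigma>\<theta> > 0 \<Longrightarrow> \<sigma>\<epsilon> > 0 \<Longrightarrow> posterior_sd \<sigma>\<theta> \<sigma>\<epsilon> > 0"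
  by (simp add: posterior_sd_def add_pos_pos)

lemma posterior_sd_eq: "posterior_sd \<sigma>\<theta> \<sigma>\<epsilon> = \<sigma>\<epsilon> * \<sigma>\<theta> / total_sd \<sigma>\<theta> \<sigma>\<epsilon>"
  by (simp add: posterior_sd_def total_sd_def add.commute)

lemma posterior_weight_eq: "\<tau> \<sigma>\<theta> \<sigma>\<epsilon> = \<sigma>\<theta>\<^sup>2 / (total_sd \<sigma>\<theta> \<sigma>\<epsilon>)\<^sup>2"
  by (simp add: posterior_weight_def total_sd_def add.commute)

lemma posterior_weight_pos: "\<sigma>\<theta> > 0 \<Longrightarrow> \<tau> \<sigma>\<theta> \<sigma>\<epsilon> > 0"
  by (simp add: posterior_weight_def add_nonneg_pos)

lemma one_minus_posterior_weight:
  assumes "\<sigma>\<epsilon> > 0"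
  shows "1 - \<tau> \<sigma>\<theta> \<sigma>\<epsilon> = \<sigma>\<epsilon>\<^sup>2 / (total_sd \<sigma>\<theta> \<sigma>\<epsilon>)\<^sup>2"
proof -
  have "\<sigma>\<epsilon>\<^sup>2 + \<sigma>\<theta>\<^sup>2 > 0" using assms by (simp add: add_pos_nonneg)
  moreover have "(total_sd \<sigma>\<theta> \<sigma>\<epsilon>)\<^sup>2 = \<sigma>\<epsilon>\<^sup>2 + \<sigma>\<theta>\<^sup>2"
    by (simp add: total_sd_def add.commute)
  ultimately have "\<sigma>\<epsilon>\<^sup>2 / (total_sd \<sigma>\<theta> \<sigma>\<epsilon>)\<^sup>2 + \<tau> \<sigma>\<theta> \<sigma>\<epsilon> = 1"
    unfolding posterior_weight_def by (metis add_divide_distrib divide_self less_irrefl)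
  then show ?thesis by simp
qed

lemma posterior_sd_le:
  assumes "\<sigma>\<theta> > 0" "\<sigma>\<epsilon> > 0"
  shows "posterior_sd \<sigma>\<theta> \<sigma>\<epsilon> \<le> \<sigma>\<epsilon>"
proof -
  have "\<sigma>\<theta> \<le> total_sd \<sigma>\<theta> \<sigma>\<epsilon>"
    using assms by (simp add: total_sd_def real_le_rsqrt)
  then show ?thesis
    using assms total_sd_pos[of \<sigma>\<epsilon> \<sigma>\<theta>] by (simp add: posterior_sd_eq field_simps)
qed

text \<open>Bayes' rule for densities: the joint density of quality and signal is prior times noise,
  and also marginal of the signal times posterior.\<close>

lemma normal_density_bayes:
  assumes "\<sigma>\<theta> > 0" "\<sigma>\<epsilon> > 0"
  shows "normal_density \<theta> \<sigma>\<theta> v * normal_density v \<sigma>\<epsilon> x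
    = normal_density \<theta> (total_sd \<sigma>\<theta> \<sigma>\<epsilon>) x
      * normal_density (\<tau> \<sigma>\<theta> \<sigma>\<epsilon> * x + (1 - \<tau> \<sigma>\<theta> \<sigma>\<epsilon>) * \<theta>) (posterior_sd \<sigma>\<theta> \<sigma>\<epsilon>) v"
proof -
  define a b where "a = \<sigma>\<theta>\<^sup>2" and "b = \<sigma>\<epsilon>\<^sup>2"
  have ab: "a > 0" "b > 0" using assms by (auto simp: a_def b_def)
  have T: "\<tau> \<sigma>\<theta> \<sigma>\<epsilon> = a / (a + b)" "(total_sd \<sigma>\<theta> \<sigma>\<epsilon>)\<^sup>2 = a + b"
    "(posterior_sd \<sigma>\<theta> \<sigma>\<epsilon>)\<^sup>2 = a * b / (a + b)"
    using ab by (auto simp: posterior_weight_def total_sd_def posterior_sd_def a_def b_def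
        add.commute power_divide power_mult_distrib)
  define m where "m = a / (a + b) * x + (1 - a / (a + b)) * \<theta>"
  \<comment> \<open>The posterior mean as a precision-weighted average, in a form with a single
    denominator.\<close>
  have m: "m = (a * x + b * \<theta>) / (a + b)"
  proof -
    have "a / (a + b) + b / (a + b) = 1"
      using ab by (simp add: add_divide_distrib[symmetric])
    then have "1 - a / (a + b) = b / (a + b)" by simp
    then show ?thesis by (simp add: m_def add_divide_distrib)
  qed
  have E: "-(v - \<theta>)\<^sup>2 / (2 * a) + (-(x - v)\<^sup>2 / (2 * b))
      = -(x - \<theta>)\<^sup>2 / (2 * (a + b)) + (-(v - m)\<^sup>2 / (2 * (a * b / (a + b))))"
  proof -
    define d where "d = a + b"
    have d: "d > 0" using ab by (simp add: d_def)
    have vm: "v - m = (d * v - (a * x + b * \<theta>)) / d"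
      using d unfolding m d_def by (simp add: field_simps)
    \<comment> \<open>Completing the square in \<open>v\<close>, with the denominators cleared so
      that it becomes a polynomial identity.\<close>
    have key: "d * (b * (v - \<theta>)\<^sup>2 + a * (x - v)\<^sup>2) = a * b * (x - \<theta>)\<^sup>2 + (d * v - (a * x + b * \<theta>))\<^sup>2"
      unfolding d_def by (simp add: power2_eq_square algebra_simps)
    have "-(v - \<theta>)\<^sup>2 / (2 * a) + (-(x - v)\<^sup>2 / (2 * b))
        = - (d * (b * (v - \<theta>)\<^sup>2 + a * (x - v)\<^sup>2)) / (2 * a * b * d)"
      using ab d by (simp add: field_simps)
    also have "\<dots> = -(x - \<theta>)\<^sup>2 / (2 * d) + (-(v - m)\<^sup>2 / (2 * (a * b / d)))"
      unfolding key vm using ab d by (simp add: field_simps power2_eq_square)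
    finally show ?thesis by (simp add: d_def)
  qed
  \<comment> \<open>The normalizing constants agree because the product of the two variances is
    \<open>a * b\<close> on either side.\<close>
  have P: "sqrt (2 * pi * a) * sqrt (2 * pi * b) = sqrt (2 * pi * (a + b)) * sqrt (2 * pi * (a * b / (a + b)))"
    unfolding real_sqrt_mult[symmetric] using ab by (simp add: field_simps)
  have "normal_density \<theta> \<sigma>\<theta> v * normal_density v \<sigma>\<epsilon> x
      = exp (-(v - \<theta>)\<^sup>2 / (2 * a) + (-(x - v)\<^sup>2 / (2 * b))) / (sqrt (2 * pi * a) * sqrt (2 * pi * b))"
    by (simp add: normal_density_def a_def b_def exp_add[symmetric])
  also have "\<dots> = exp (-(x - \<theta>)\<^sup>2 / (2 * (a + b)) + (-(v - m)\<^sup>2 / (2 * (a * b / (a + b)))))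
      / (sqrt (2 * pi * (a + b)) * sqrt (2 * pi * (a * b / (a + b))))"
    unfolding E P ..
  also have "\<dots> = normal_density \<theta> (total_sd \<sigma>\<theta> \<sigma>\<epsilon>) x
      * normal_density (\<tau> \<sigma>\<theta> \<sigma>\<epsilon> * x + (1 - \<tau> \<sigma>\<theta> \<sigma>\<epsilon>) * \<theta>) (posterior_sd \<sigma>\<theta> \<sigma>\<epsilon>) v"
    unfolding normal_density_def T m_def[symmetric] exp_add by simp
  finally show ?thesis .
qed

text \<open>The measure itself varies with \<open>x\<close>. Moving this dependence into a density
  turns the expression into a Lebesgue integral with a parameter and a jointly measurable
  integrand.\<close>

lemma borel_measurable_posterior_reward:
  assumes "\<sigma>\<theta> > 0" "\<sigma>\<epsilon> > 0" and r[measurable]: "r \<in> borel_measurable borel"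
  shows "posterior_reward \<theta> \<sigma>\<theta> \<sigma>\<epsilon> r \<in> borel_measurable borel"
proof -
  have "posterior_reward \<theta> \<sigma>\<theta> \<sigma>\<epsilon> r = (\<lambda>x. \<integral>v. normal_density
      (\<tau> \<sigma>\<theta> \<sigma>\<epsilon> * x + (1 - \<tau> \<sigma>\<theta> \<sigma>\<epsilon>) * \<theta>) (posterior_sd \<sigma>\<theta> \<sigma>\<epsilon>) v * r v \<partial>lborel)"
    using r by (auto simp: posterior_reward_def posterior_def integral_normal_distribution)
  also have "\<dots> \<in> borel_measurable borel"
    unfolding normal_density_def by measurable
  finally show ?thesis .
qed

text \<open>\<open>\<Phi> ((v - c) / \<sigma>\<epsilon>)\<close> is the probability of a signal in
  \<open>{c..}\<close> given quality \<open>v\<close>. Both sides are therefore the mean of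
  \<open>g v\<close> on that event, conditioned first on quality and then on the signal.\<close>

lemma integral_Phi_eq_integral_posterior:
  assumes pos: "\<sigma>\<theta> > 0" "\<sigma>\<epsilon> > 0"
    and g[measurable]: "g \<in> borel_measurable borel" and gB: "\<And>v. \<bar>g v\<bar> \<le> B"
  shows "(\<integral>v. g v * \<Phi> ((v - c) / \<sigma>\<epsilon>) \<partial>normal_distribution \<theta> \<sigma>\<theta>)
    = (\<integral>x. indicator {c..} x * posterior_reward \<theta> \<sigma>\<theta> \<sigma>\<epsilon> g x
        \<partial>normal_distribution \<theta> (total_sd \<sigma>\<theta> \<sigma>\<epsilon>))"
proof -
  define q where "q = (\<lambda>v x. normal_density \<theta> \<sigma>\<theta> v * normal_density v \<sigma>\<epsilon> x)"
  define F where "F = (\<lambda>v x. q v x * (g v * indicator {c..} x))"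
  have q_nonneg: "0 \<le> q v x" for v x by (simp add: q_def)
  have q_meas[measurable]: "case_prod q \<in> borel_measurable (lborel \<Otimes>\<^sub>M lborel)"
    unfolding q_def normal_density_def by measurable
  have F_meas[measurable]: "case_prod F \<in> borel_measurable (lborel \<Otimes>\<^sub>M lborel)"
    unfolding F_def by measurable
  have B: "0 \<le> B" using gB[of 0] by linarith
  \<comment> \<open>Integrating the joint density over the signal leaves the prior density. As
    \<open>g\<close> is bounded by \<open>B\<close>, the function \<open>B * q\<close> then
    dominates \<open>F\<close>, which licenses Fubini.\<close>
  have "integrable (lborel \<Otimes>\<^sub>M lborel) (case_prod q)"
  proof (rule lborel_pair.Fubini_integrable)
    have "(\<lambda>v. \<integral>x. norm (case_prod q (v, x)) \<partial>lborel) = normal_density \<theta> \<sigma>\<theta>"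
      using pos by (auto simp: q_def abs_mult integral_normal_density)
    then show "integrable lborel (\<lambda>v. \<integral>x. norm (case_prod q (v, x)) \<partial>lborel)"
      using pos by (simp add: integrable_normal_density)
    show "AE v in lborel. integrable lborel (\<lambda>x. case_prod q (v, x))"
      using pos by (auto simp: q_def intro!: integrable_normal_density)
  qed measurable
  then have "integrable (lborel \<Otimes>\<^sub>M lborel) (\<lambda>z. B * case_prod q z)"
    by (rule integrable_mult_right)
  then have F_int: "integrable (lborel \<Otimes>\<^sub>M lborel) (case_prod F)"
  proof (rule Bochner_Integration.integrable_bound)
    have "\<bar>F v x\<bar> \<le> B * q v x" for v x
    proof -
      have "\<bar>F v x\<bar> \<le> q v x * B"
        unfolding F_def abs_mult using gB[of v] q_nonneg[of v x] B
        by (intro mult_mono) (auto simp: indicator_def)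
      then show ?thesis by (simp add: mult.commute)
    qed
    then show "AE z in lborel \<Otimes>\<^sub>M lborel. norm (case_prod F z) \<le> norm (B * case_prod q z)"
      using B q_nonneg by (auto simp: abs_mult)
  qed measurable
  \<comment> \<open>Measurability of \<open>\<Phi>\<close> is read off its representation as an
    integral with parameter \<open>v\<close>.\<close>
  have Phi_meas[measurable]: "(\<lambda>v. \<Phi> ((v - c) / \<sigma>\<epsilon>)) \<in> borel_measurable borel"
    unfolding Phi_eq_integral[OF pos(2)] normal_density_def by measurable
  have "(\<integral>v. g v * \<Phi> ((v - c) / \<sigma>\<epsilon>) \<partial>normal_distribution \<theta> \<sigma>\<theta>)
      = (\<integral>v. normal_density \<theta> \<sigma>\<theta> v * (g v * \<Phi> ((v - c) / \<sigma>\<epsilon>)) \<partial>lborel)"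
    by (rule integral_normal_distribution) measurable
  also have "\<dots> = (\<integral>v. \<integral>x. F v x \<partial>lborel \<partial>lborel)"
  proof (rule Bochner_Integration.integral_cong[OF refl])
    fix v
    have "(\<integral>x. F v x \<partial>lborel)
        = (\<integral>x. (normal_density \<theta> \<sigma>\<theta> v * g v) * (normal_density v \<sigma>\<epsilon> x * indicator {c..} x) \<partial>lborel)"
      by (simp add: F_def q_def mult_ac)
    then show "normal_density \<theta> \<sigma>\<theta> v * (g v * \<Phi> ((v - c) / \<sigma>\<epsilon>)) = (\<integral>x. F v x \<partial>lborel)"
      by (simp add: Phi_eq_integral[OF pos(2)] mult_ac)
  qed
  also have "\<dots> = (\<integral>x. \<integral>v. F v x \<partial>lborel \<partial>lborel)"
    by (rule lborel_pair.Fubini_integral[OF F_int, symmetric])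
  also have "\<dots> = (\<integral>x. normal_density \<theta> (total_sd \<sigma>\<theta> \<sigma>\<epsilon>) x
      * (indicator {c..} x * posterior_reward \<theta> \<sigma>\<theta> \<sigma>\<epsilon> g x) \<partial>lborel)"
  proof (rule Bochner_Integration.integral_cong[OF refl])
    fix x
    let ?d = "normal_density (\<tau> \<sigma>\<theta> \<sigma>\<epsilon> * x + (1 - \<tau> \<sigma>\<theta> \<sigma>\<epsilon>) * \<theta>) (posterior_sd \<sigma>\<theta> \<sigma>\<epsilon>)"
    have "(\<integral>v. F v x \<partial>lborel) = (\<integral>v. (normal_density \<theta> (total_sd \<sigma>\<theta> \<sigma>\<epsilon>) x * indicator {c..} x)
        * (?d v * g v) \<partial>lborel)"
      unfolding F_def q_def normal_density_bayes[OF pos] by (simp add: mult_ac)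
    also have "\<dots> = (normal_density \<theta> (total_sd \<sigma>\<theta> \<sigma>\<epsilon>) x * indicator {c..} x) * (\<integral>v. ?d v * g v \<partial>lborel)"
      by (rule integral_mult_right_zero)
    finally show "(\<integral>v. F v x \<partial>lborel) = normal_density \<theta> (total_sd \<sigma>\<theta> \<sigma>\<epsilon>) x
      * (indicator {c..} x * posterior_reward \<theta> \<sigma>\<theta> \<sigma>\<epsilon> g x)"
      by (simp add: posterior_reward_def posterior_def integral_normal_distribution mult_ac)
  qed
  also have "\<dots> = (\<integral>x. indicator {c..} x * posterior_reward \<theta> \<sigma>\<theta> \<sigma>\<epsilon> g x
        \<partial>normal_distribution \<theta> (total_sd \<sigma>\<theta> \<sigma>\<epsilon>))"
    using borel_measurable_posterior_reward[OF pos g]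
    by (intro integral_normal_distribution[symmetric]) measurable
  finally show ?thesis .
qed

section \<open>Rewards and profits\<close>

lemma posterior_reward_bounds:
  assumes "\<sigma>\<theta> > 0" "\<sigma>\<epsilon> > 0" "reward_program p r"
  shows "0 \<le> posterior_reward \<theta> \<sigma>\<theta> \<sigma>\<epsilon> r x \<and> posterior_reward \<theta> \<sigma>\<theta> \<sigma>\<epsilon> r x \<le> p"
proof -
  define m where "m = \<tau> \<sigma>\<theta> \<sigma>\<epsilon> * x + (1 - \<tau> \<sigma>\<theta> \<sigma>\<epsilon>) * \<theta>"
  note s = posterior_sd_pos[OF assms(1,2)]
  interpret prob_space "normal_distribution m (posterior_sd \<sigma>\<theta> \<sigma>\<epsilon>)"
    by (rule prob_space_normal_distribution) fact
  have r: "r \<in> borel_measurable borel" "\<And>v. 0 \<le> r v \<and> r v \<le> p"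
    using assms(3) by (auto simp: reward_program_def)
  have "integrable (normal_distribution m (posterior_sd \<sigma>\<theta> \<sigma>\<epsilon>)) r"
    using r by (intro integrable_normal_distribution_bounded[OF s, where B = p]) auto
  then have "(\<integral>v. r v \<partial>normal_distribution m (posterior_sd \<sigma>\<theta> \<sigma>\<epsilon>)) \<le> p"
    using r by (intro integral_le_const) auto
  moreover have "0 \<le> (\<integral>v. r v \<partial>normal_distribution m (posterior_sd \<sigma>\<theta> \<sigma>\<epsilon>))"
    using r by (intro integral_nonneg_AE) auto
  ultimately show ?thesis
    by (simp add: posterior_reward_def posterior_def m_def)
qed

lemma posterior_reward_diff:
  assumes "\<sigma>\<theta> > 0" "\<sigma>\<epsilon> > 0" "reward_program p r"
  shows "posterior_reward \<theta> \<sigma>\<theta> \<sigma>\<epsilon> (\<lambda>v. p - r v) x = p - posterior_reward \<theta> \<sigma>\<theta> \<sigma>\<epsilon> r x"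
proof -
  define m where "m = \<tau> \<sigma>\<theta> \<sigma>\<epsilon> * x + (1 - \<tau> \<sigma>\<theta> \<sigma>\<epsilon>) * \<theta>"
  note s = posterior_sd_pos[OF assms(1,2)]
  interpret prob_space "normal_distribution m (posterior_sd \<sigma>\<theta> \<sigma>\<epsilon>)"
    by (rule prob_space_normal_distribution) fact
  have r: "r \<in> borel_measurable borel" "\<And>v. 0 \<le> r v \<and> r v \<le> p"
    using assms(3) by (auto simp: reward_program_def)
  have "integrable (normal_distribution m (posterior_sd \<sigma>\<theta> \<sigma>\<epsilon>)) r"
    using r by (intro integrable_normal_distribution_bounded[OF s, where B = p]) auto
  then show ?thesis
    using prob_space by (simp add: posterior_reward_def posterior_def m_def[symmetric])
qed

lemma expected_profit_eq:
  assumes "\<sigma>\<theta> > 0" "\<sigma>\<epsilon> > 0" "reward_program p r"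
  shows "expected_profit \<theta> \<sigma>\<theta> \<sigma>\<epsilon> p r c
    = (\<integral>x. indicator {c..} x * (p - posterior_reward \<theta> \<sigma>\<theta> \<sigma>\<epsilon> r x)
        \<partial>normal_distribution \<theta> (total_sd \<sigma>\<theta> \<sigma>\<epsilon>))"
proof -
  have r: "r \<in> borel_measurable borel" "\<And>v. 0 \<le> r v \<and> r v \<le> p"
    using assms(3) by (auto simp: reward_program_def)
  have "\<bar>p - r v\<bar> \<le> p" for v using r(2)[of v] by auto
  moreover have "(\<lambda>v. p - r v) \<in> borel_measurable borel" using r(1) by simp
  ultimately show ?thesis
    unfolding expected_profit_def
    by (subst integral_Phi_eq_integral_posterior[OF assms(1,2), where B = p])
       (simp_all add: posterior_reward_diff[OF assms])
qed

section \<open>An upper bound for the profit of all feasible programs\<close>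

definition profit_bound :: "real \<Rightarrow> real \<Rightarrow> real \<Rightarrow> real"
  where "profit_bound \<theta> \<sigma> p = (\<integral>x. max 0 (min p x) \<partial>normal_distribution \<theta> \<sigma>)"

text \<open>A zero integral would make the integrand vanish almost everywhere, but it is positive on
  the whole interval \<open>{0<..<p}\<close>. Positivity allows division by the bound in the limit
  argument.\<close>

lemma profit_bound_pos:
  assumes "\<sigma> > 0" "p > 0"
  shows "profit_bound \<theta> \<sigma> p > 0"
proof -
  have int: "integrable lborel (\<lambda>x. normal_density \<theta> \<sigma> x * max 0 (min p x))"
    using integrable_normal_distribution_bounded[OF assms(1), of "\<lambda>x. max 0 (min p x)" p \<theta>] assms(2)
    by (simp add: integrable_normal_distribution_iff)
  have eq: "profit_bound \<theta> \<sigma> p = (\<integral>x. normal_density \<theta> \<sigma> x * max 0 (min p x) \<partial>lborel)"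
    unfolding profit_bound_def by (rule integral_normal_distribution) measurable
  have "profit_bound \<theta> \<sigma> p \<noteq> 0"
  proof
    assume "profit_bound \<theta> \<sigma> p = 0"
    then have "AE x in lborel. normal_density \<theta> \<sigma> x * max 0 (min p x) = 0"
      unfolding eq by (subst (asm) integral_nonneg_eq_0_iff_AE[OF int]) auto
    then have "AE x in lborel. x \<notin> {0<..<p}"
    proof eventually_elim
      case (elim x)
      then show ?case using normal_density_pos[OF assms(1), of \<theta> x] by auto
    qed
    then have "emeasure lborel {0<..<p} = 0"
      by (subst (asm) AE_iff_measurable[of "{0<..<p}"]) auto
    then show False using assms(2) by simp
  qed
  moreover have "profit_bound \<theta> \<sigma> p \<ge> 0"
    unfolding eq by (intro integral_nonneg_AE) auto
  ultimately show ?thesis by simp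
qed

lemma expected_profit_le:
  assumes pos: "\<sigma>\<theta> > 0" "\<sigma>\<epsilon> > 0" and f: "feasible \<theta> \<sigma>\<theta> \<sigma>\<epsilon> p r c"
  shows "expected_profit \<theta> \<sigma>\<theta> \<sigma>\<epsilon> p r c \<le> profit_bound \<theta> (total_sd \<sigma>\<theta> \<sigma>\<epsilon>) p"
proof -
  have r: "reward_program p r" using f by (simp add: feasible_def)
  have rb[measurable]: "r \<in> borel_measurable borel" and p: "0 \<le> p"
    using r order_trans[of 0 "r 0" p] by (auto simp: reward_program_def)
  note bd = posterior_reward_bounds[OF pos r, of \<theta>]
  note [measurable] = borel_measurable_posterior_reward[OF pos rb, of \<theta>]
  show ?thesis
    unfolding expected_profit_eq[OF pos r] profit_bound_def
  proof (rule integral_mono)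
    show "integrable (normal_distribution \<theta> (total_sd \<sigma>\<theta> \<sigma>\<epsilon>))
        (\<lambda>x. indicator {c..} x * (p - posterior_reward \<theta> \<sigma>\<theta> \<sigma>\<epsilon> r x))"
      using bd p
      by (intro integrable_normal_distribution_bounded[OF total_sd_pos[OF pos(2)], where B = p])
         (auto simp: indicator_def)
    show "integrable (normal_distribution \<theta> (total_sd \<sigma>\<theta> \<sigma>\<epsilon>)) (\<lambda>x. max 0 (min p x))"
      using p by (intro integrable_normal_distribution_bounded[OF total_sd_pos[OF pos(2)], where B = p]) auto
    fix x
    show "indicator {c..} x * (p - posterior_reward \<theta> \<sigma>\<theta> \<sigma>\<epsilon> r x) \<le> max 0 (min p x)"
    \<comment> \<open>For a buyer, the purchase constraint bounds the margin by \<open>x\<close> and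
      a nonnegative reward bounds it by \<open>p\<close>; a consumer who does not buy contributes
      0.\<close>
    proof (cases "x \<ge> c")
      case True
      then have "posterior_reward \<theta> \<sigma>\<theta> \<sigma>\<epsilon> r x + x - p \<ge> 0"
        using f by (simp add: feasible_def)
      then show ?thesis using True bd[of x] by simp
    qed simp
  qed
qed

text \<open>Both families of weak inequalities include the point \<open>x = c\<close>.\<close>

lemma feasible_cutoff:
  assumes "feasible \<theta> \<sigma>\<theta> \<sigma>\<epsilon> p r c"
  shows "c + posterior_reward \<theta> \<sigma>\<theta> \<sigma>\<epsilon> r c = p"
proof -
  have "posterior_reward \<theta> \<sigma>\<theta> \<sigma>\<epsilon> r c + c - p \<ge> 0" "posterior_reward \<theta> \<sigma>\<theta> \<sigma>\<epsilon> r c + c - p \<le> 0"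
    using assms by (auto simp: feasible_def)
  then show ?thesis by linarith
qed

text \<open>The last premise says that \<open>x + posterior_reward \<theta> \<sigma>\<theta>
  \<sigma>\<epsilon> r x\<close> is nondecreasing in \<open>x\<close>. Its value \<open>p\<close> at
  \<open>c\<close> then separates buyers from the rest.\<close>

lemma feasibleI:
  assumes "reward_program p r" and "c + posterior_reward \<theta> \<sigma>\<theta> \<sigma>\<epsilon> r c = p"
    and "\<And>x y. x \<le> y \<Longrightarrow> posterior_reward \<theta> \<sigma>\<theta> \<sigma>\<epsilon> r x - posterior_reward \<theta> \<sigma>\<theta> \<sigma>\<epsilon> r y \<le> y - x"
  shows "feasible \<theta> \<sigma>\<theta> \<sigma>\<epsilon> p r c"
  unfolding feasible_def using assms(1,2) assms(3)[of c] assms(3)[of _ c] by force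

section \<open>The spread constraint\<close>

lemma feasible_SC_iff_feasible:
  assumes pos: "\<sigma>\<theta> > 0" "\<sigma>\<epsilon> > 0"
    and ratio: "\<sigma>\<epsilon> / \<sigma>\<theta> \<ge> p / (sqrt (2 * pi) * total_sd \<sigma>\<theta> \<sigma>\<epsilon>)"
  shows "feasible_SC \<theta> \<sigma>\<theta> \<sigma>\<epsilon> p r c \<longleftrightarrow> feasible \<theta> \<sigma>\<theta> \<sigma>\<epsilon> p r c"
proof -
  define \<sigma> where "\<sigma> = total_sd \<sigma>\<theta> \<sigma>\<epsilon>"
  have \<sigma>: "\<sigma> > 0" by (simp add: \<sigma>_def total_sd_pos pos)
  \<comment> \<open>The hypothesis on the ratio says that \<open>p\<close> is at most the cap on the
    spread, and values in \<open>[0, p]\<close> have spread at most \<open>p\<close>.\<close>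
  have p_le: "p \<le> sqrt (2 * pi) * (\<sigma>\<epsilon> * \<sigma> / \<sigma>\<theta>)"
    using ratio pos \<sigma> unfolding \<sigma>_def[symmetric] by (simp add: field_simps)
  show ?thesis
  proof
    assume f: "feasible \<theta> \<sigma>\<theta> \<sigma>\<epsilon> p r c"
    then have r: "reward_program p r" by (simp add: feasible_def)
    then have "(SUP v. r v) \<le> p" "0 \<le> (INF v. r v)"
      by (auto simp: reward_program_def intro!: cSUP_least cINF_greatest)
    then show "feasible_SC \<theta> \<sigma>\<theta> \<sigma>\<epsilon> p r c"
      using r p_le feasible_cutoff[OF f] by (auto simp: feasible_SC_def \<sigma>_def)
  next
    assume f: "feasible_SC \<theta> \<sigma>\<theta> \<sigma>\<epsilon> p r c"
    then have r: "reward_program p r" by (simp add: feasible_SC_def)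
    show "feasible \<theta> \<sigma>\<theta> \<sigma>\<epsilon> p r c"
    proof (rule feasibleI[OF r])
      show "c + posterior_reward \<theta> \<sigma>\<theta> \<sigma>\<epsilon> r c = p"
        using f by (simp add: feasible_SC_def)
      fix x y :: real assume xy: "x \<le> y"
      define t s where "t = \<tau> \<sigma>\<theta> \<sigma>\<epsilon>" and "s = posterior_sd \<sigma>\<theta> \<sigma>\<epsilon>"
      have t: "t > 0" and s: "s > 0"
        by (auto simp: t_def s_def posterior_weight_pos posterior_sd_pos pos)
      have "posterior_reward \<theta> \<sigma>\<theta> \<sigma>\<epsilon> r x - posterior_reward \<theta> \<sigma>\<theta> \<sigma>\<epsilon> r y
          \<le> p * ((t * y + (1 - t) * \<theta>) - (t * x + (1 - t) * \<theta>)) / (s * sqrt (2 * pi))"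
        unfolding posterior_reward_def posterior_def t_def[symmetric] s_def[symmetric]
        using r xy t by (intro integral_normal_bounded_decrease_le[OF s])
          (auto simp: reward_program_def)
      also have "\<dots> = (p * t / (s * sqrt (2 * pi))) * (y - x)"
        by (simp add: field_simps)
      \<comment> \<open>The slope bound is \<open>p\<close> divided by the cap on the spread, so the
        same inequality that makes the cap harmless makes the slope at most 1.\<close>
      also have "p * t / (s * sqrt (2 * pi)) = p / (sqrt (2 * pi) * (\<sigma>\<epsilon> * \<sigma> / \<sigma>\<theta>))"
        using pos \<sigma> unfolding t_def s_def posterior_weight_eq posterior_sd_eq \<sigma>_def[symmetric]
        by (simp add: field_simps power2_eq_square)
      also have "\<dots> * (y - x) \<le> 1 * (y - x)"
        using xy p_le pos \<sigma> by (intro mult_right_mono) (auto simp only: divide_le_eq_1_pos mult_pos_pos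
            divide_pos_pos real_sqrt_gt_zero pi_gt_zero zero_less_numeral diff_ge_0_iff_ge)
      finally show "posterior_reward \<theta> \<sigma>\<theta> \<sigma>\<epsilon> r x - posterior_reward \<theta> \<sigma>\<theta> \<sigma>\<epsilon> r y \<le> y - x"
        by simp
    qed
  qed
qed

section \<open>The rate constraint\<close>

text \<open>The posterior mean moves with the signal at rate
  \<open>\<tau> \<sigma>\<theta> \<sigma>\<epsilon>\<close>, which cancels the rate
  \<open>1 / \<tau> \<sigma>\<theta> \<sigma>\<epsilon>\<close> allowed for
  \<open>r\<close>.\<close>

lemma posterior_reward_lipschitz:
  assumes pos: "\<sigma>\<theta> > 0" "\<sigma>\<epsilon> > 0" and r: "reward_program p r"
    and L: "\<And>u v. \<bar>r u - r v\<bar> \<le> 1 / \<tau> \<sigma>\<theta> \<sigma>\<epsilon> * \<bar>u - v\<bar>"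
  shows "\<bar>posterior_reward \<theta> \<sigma>\<theta> \<sigma>\<epsilon> r x - posterior_reward \<theta> \<sigma>\<theta> \<sigma>\<epsilon> r y\<bar> \<le> \<bar>x - y\<bar>"
proof -
  define t where "t = \<tau> \<sigma>\<theta> \<sigma>\<epsilon>"
  have t: "t > 0" by (simp add: t_def posterior_weight_pos pos)
  have "\<bar>posterior_reward \<theta> \<sigma>\<theta> \<sigma>\<epsilon> r x - posterior_reward \<theta> \<sigma>\<theta> \<sigma>\<epsilon> r y\<bar>
      \<le> 1 / t * \<bar>(t * x + (1 - t) * \<theta>) - (t * y + (1 - t) * \<theta>)\<bar>"
    unfolding posterior_reward_def posterior_def t_def[symmetric]
    using r L by (intro integral_normal_lipschitz[OF posterior_sd_pos[OF pos], where B = p])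
      (auto simp: reward_program_def t_def)
  also have "(t * x + (1 - t) * \<theta>) - (t * y + (1 - t) * \<theta>) = t * (x - y)"
    by (simp add: algebra_simps)
  finally show ?thesis using t by (simp add: abs_mult)
qed

text \<open>The derivative bound is integrated. Continuity lets the fundamental theorem of calculus
  pass over the finitely many exceptional points.\<close>

lemma piecewise_C1_lipschitz:
  fixes f :: "real \<Rightarrow> real"
  assumes f: "f piecewise_C1_differentiable_on UNIV"
    and D: "\<And>v. f differentiable at v \<Longrightarrow> \<bar>deriv f v\<bar> \<le> L" and L: "0 \<le> L"
  shows "\<bar>f u - f v\<bar> \<le> L * \<bar>u - v\<bar>"
proof -
  from f obtain S where S: "finite S" "f C1_differentiable_on (UNIV - S)" and cont: "continuous_on UNIV f"
    by (auto simp: piecewise_C1_differentiable_on_def)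
  have d: "(f has_real_derivative deriv f x) (at x) \<and> \<bar>deriv f x\<bar> \<le> L" if "x \<notin> S" for x
  proof -
    have "f differentiable at x"
      using S(2) that by (auto simp: C1_differentiable_on_eq)
    then show ?thesis
      using D[of x] real_differentiable_def DERIV_imp_deriv by metis
  qed
  have *: "\<bar>f b - f a\<bar> \<le> L * (b - a)" if "a \<le> b" for a b
  proof -
    have "(deriv f has_integral (f b - f a)) {a..b}"
    proof (rule fundamental_theorem_of_calculus_interior_strong[OF S(1) that])
      show "(f has_vector_derivative deriv f x) (at x)" if "x \<in> {a<..<b} - S" for x
        using d[of x] that by (simp add: has_real_derivative_iff_has_vector_derivative)
      show "continuous_on {a..b} f"
        using cont continuous_on_subset by blast
    qed
    \<comment> \<open>At a kink \<open>deriv f\<close> is unspecified, hence a bound on the integral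
      that tolerates a finite exceptional set.\<close>
    then have "norm (f b - f a) \<le> L * measure lborel (cbox a b)"
      using d by (intro has_integral_bound_spike_finite[OF L S(1), of "deriv f"]) auto
    then show ?thesis using that by simp
  qed
  show ?thesis
    using *[of u v] *[of v u] by (cases "u \<le> v") (auto simp: abs_minus_commute)
qed

lemma feasible_RC_imp_feasible:
  assumes pos: "\<sigma>\<theta> > 0" "\<sigma>\<epsilon> > 0" and f: "feasible_RC \<theta> \<sigma>\<theta> \<sigma>\<epsilon> p r c"
  shows "feasible \<theta> \<sigma>\<theta> \<sigma>\<epsilon> p r c"
proof (rule feasibleI)
  show r: "reward_program p r" and "c + posterior_reward \<theta> \<sigma>\<theta> \<sigma>\<epsilon> r c = p"
    using f by (auto simp: feasible_RC_def)
  have "\<bar>r u - r v\<bar> \<le> 1 / \<tau> \<sigma>\<theta> \<sigma>\<epsilon> * \<bar>u - v\<bar>" for u v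
    using f posterior_weight_pos[OF pos(1), of \<sigma>\<epsilon>]
    by (intro piecewise_C1_lipschitz) (auto simp: feasible_RC_def)
  from posterior_reward_lipschitz[OF pos r this]
  show "posterior_reward \<theta> \<sigma>\<theta> \<sigma>\<epsilon> r x - posterior_reward \<theta> \<sigma>\<theta> \<sigma>\<epsilon> r y \<le> y - x" if "x \<le> y" for x y
    using that by (smt (verit, best))
qed

text \<open>For \<open>p > 0\<close> the value is \<open>p\<close> up to \<delta>, then falls with
  slope -1 to 0 at \<open>p + \<delta>\<close>. This is a competitor whose profit bounds that of the
  rate-constrained optimum from below, not that optimum itself, whose slope is steeper.\<close>

definition ramp :: "real \<Rightarrow> real \<Rightarrow> real \<Rightarrow> real"
  where "ramp p \<delta> v = max 0 (min p (p - v + \<delta>))"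

lemma ramp_lipschitz: "\<bar>ramp p \<delta> u - ramp p \<delta> v\<bar> \<le> \<bar>u - v\<bar>"
  unfolding ramp_def by linarith

lemma reward_program_ramp: "0 \<le> p \<Longrightarrow> reward_program p (ramp p \<delta>)"
  by (auto simp: reward_program_def ramp_def[abs_def])

lemma ramp_piecewise_C1:
  assumes "p > 0"
  shows "ramp p \<delta> piecewise_C1_differentiable_on UNIV"
  unfolding piecewise_C1_differentiable_on_def
proof (intro conjI exI)
  show "continuous_on UNIV (ramp p \<delta>)"
    unfolding ramp_def by (intro continuous_intros)
  show "finite {\<delta>, p + \<delta>}" by simp
  define D where "D v = (if v < \<delta> then 0 else if v < p + \<delta> then - 1 else 0 :: real)" for v
  \<comment> \<open>Near any point other than the two kinks the ramp coincides with an affine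
    function and \<open>D\<close> is constant.\<close>
  have *: "(ramp p \<delta> has_vector_derivative D v) (at v) \<and> isCont D v" if "v \<notin> {\<delta>, p + \<delta>}" for v
  proof -
    consider "v \<in> {..<\<delta>}" | "v \<in> {\<delta><..<p + \<delta>}" | "v \<in> {p + \<delta><..}"
      using \<open>v \<notin> {\<delta>, p + \<delta>}\<close> by fastforce
    then show ?thesis
    proof cases
      case 1
      have "((\<lambda>v. p) has_vector_derivative D v) (at v)" using 1 by (simp add: D_def)
      then have "(ramp p \<delta> has_vector_derivative D v) (at v)"
        by (rule has_vector_derivative_transform_within_open[OF _ _ 1])
          (use assms in \<open>auto simp: ramp_def\<close>)
      moreover have "\<forall>\<^sub>F x in nhds v. D x = 0"
        using eventually_nhds_in_open[OF _ 1] by (rule eventually_mono) (auto simp: D_def)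
      ultimately show ?thesis using isCont_cong by force
    next
      case 2
      have "((\<lambda>v. p - v + \<delta>) has_vector_derivative D v) (at v)"
        using 2 by (auto simp: D_def intro!: derivative_eq_intros)
      then have "(ramp p \<delta> has_vector_derivative D v) (at v)"
        by (rule has_vector_derivative_transform_within_open[OF _ _ 2])
          (use assms in \<open>auto simp: ramp_def\<close>)
      moreover have "\<forall>\<^sub>F x in nhds v. D x = - 1"
        using eventually_nhds_in_open[OF _ 2] by (rule eventually_mono) (auto simp: D_def)
      ultimately show ?thesis using isCont_cong by force
    next
      case 3
      have "((\<lambda>v. 0) has_vector_derivative D v) (at v)" using 3 assms by (simp add: D_def)
      then have "(ramp p \<delta> has_vector_derivative D v) (at v)"
        by (rule has_vector_derivative_transform_within_open[OF _ _ 3])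
          (use assms in \<open>auto simp: ramp_def\<close>)
      moreover have "\<forall>\<^sub>F x in nhds v. D x = 0"
        using eventually_nhds_in_open[OF _ 3] by (rule eventually_mono) (use assms in \<open>auto simp: D_def\<close>)
      ultimately show ?thesis using isCont_cong by force
    qed
  qed
  then show "ramp p \<delta> C1_differentiable_on UNIV - {\<delta>, p + \<delta>}"
    unfolding C1_differentiable_on_def
    by (intro exI[of _ D]) (auto intro!: continuous_at_imp_continuous_on)
qed

text \<open>The difference quotients are bounded by \<open>L\<close>, and so is their limit. This
  yields the rate constraint for the ramp at every point of differentiability.\<close>

lemma abs_deriv_le_lipschitz:
  fixes f :: "real \<Rightarrow> real"
  assumes "f differentiable at x" and L: "\<And>u v. \<bar>f u - f v\<bar> \<le> L * \<bar>u - v\<bar>"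
  shows "\<bar>deriv f x\<bar> \<le> L"
proof -
  have "(f has_real_derivative deriv f x) (at x)"
    using assms(1) real_differentiable_def DERIV_imp_deriv by metis
  then have "(\<lambda>h. (f (x + h) - f x) / h) \<midarrow>0\<rightarrow> deriv f x"
    by (simp add: DERIV_def)
  from tendsto_rabs[OF this] show ?thesis
  proof (rule tendsto_upperbound)
    show "\<forall>\<^sub>F h in at 0. \<bar>(f (x + h) - f x) / h\<bar> \<le> L"
    proof (rule eventually_mono[OF eventually_neq_at_within[of 0]])
      fix h :: real assume "h \<noteq> 0"
      then show "\<bar>(f (x + h) - f x) / h\<bar> \<le> L"
        using L[of "x + h" x] by (simp add: abs_divide divide_le_eq)
    qed
  qed simp
qed

text \<open>The cutoff comes from the intermediate value theorem for \<open>h\<close> on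
  \<open>{0..p}\<close>: rewards are at most \<open>p\<close>, so \<open>h 0 \<le> p\<close>, and
  nonnegative, so \<open>p \<le> h p\<close>.\<close>

lemma feasible_RC_ramp:
  assumes pos: "\<sigma>\<theta> > 0" "\<sigma>\<epsilon> > 0" and p: "p > 0"
  obtains c where "0 \<le> c" "c \<le> p" "feasible_RC \<theta> \<sigma>\<theta> \<sigma>\<epsilon> p (ramp p \<delta>) c"
proof -
  note r = reward_program_ramp[OF less_imp_le[OF p], of \<delta>]
  note t = posterior_weight_pos[OF pos(1), of \<sigma>\<epsilon>]
  \<comment> \<open>Since the weight is at most 1, slope 1 respects the rate constraint for every
    noise level.\<close>
  have "\<tau> \<sigma>\<theta> \<sigma>\<epsilon> \<le> 1"
    using one_minus_posterior_weight[OF pos(2), of \<sigma>\<theta>] zero_le_divide_iff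
    by (smt (verit) zero_le_power2)
  then have t1: "1 \<le> 1 / \<tau> \<sigma>\<theta> \<sigma>\<epsilon>" using t by simp
  have L: "\<bar>ramp p \<delta> u - ramp p \<delta> v\<bar> \<le> 1 / \<tau> \<sigma>\<theta> \<sigma>\<epsilon> * \<bar>u - v\<bar>" for u v
    using ramp_lipschitz[of p \<delta> u v] mult_right_mono[OF t1, of "\<bar>u - v\<bar>"] by simp
  define h where "h x = x + posterior_reward \<theta> \<sigma>\<theta> \<sigma>\<epsilon> (ramp p \<delta>) x" for x
  have "1-lipschitz_on UNIV (posterior_reward \<theta> \<sigma>\<theta> \<sigma>\<epsilon> (ramp p \<delta>))"
    using posterior_reward_lipschitz[OF pos r L] by (auto intro!: lipschitz_onI simp: dist_real_def)
  then have "continuous_on UNIV (posterior_reward \<theta> \<sigma>\<theta> \<sigma>\<epsilon> (ramp p \<delta>))"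
    by (rule lipschitz_on_continuous_on)
  then have "continuous_on {0..p} h"
    unfolding h_def by (intro continuous_intros) (rule continuous_on_subset, auto)
  moreover have "h 0 \<le> p" "p \<le> h p"
    using posterior_reward_bounds[OF pos r, of \<theta>] by (auto simp: h_def)
  ultimately obtain c where c: "0 \<le> c" "c \<le> p" "h c = p"
    using IVT'[of h 0 p p] p by auto
  have "feasible_RC \<theta> \<sigma>\<theta> \<sigma>\<epsilon> p (ramp p \<delta>) c"
    unfolding feasible_RC_def using r ramp_piecewise_C1[OF p] c(3)
    by (auto simp: h_def intro!: abs_deriv_le_lipschitz L)
  with c that show ?thesis by blast
qed

text \<open>Two sources of error: the posterior mean is pulled from \<open>x\<close> towards
  \<theta> by the factor \<open>1 - \<tau> \<sigma>\<theta> \<sigma>\<epsilon>\<close>, and the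
  posterior has standard deviation at most \<open>\<sigma>\<epsilon>\<close>.\<close>

lemma posterior_reward_ramp_error:
  assumes pos: "\<sigma>\<theta> > 0" "\<sigma>\<epsilon> > 0" and p: "p > 0"
  shows "\<bar>posterior_reward \<theta> \<sigma>\<theta> \<sigma>\<epsilon> (ramp p \<delta>) x - ramp p \<delta> x\<bar>
    \<le> \<sigma>\<epsilon>\<^sup>2 / (total_sd \<sigma>\<theta> \<sigma>\<epsilon>)\<^sup>2 * \<bar>x - \<theta>\<bar> + \<sigma>\<epsilon>"
proof -
  define t where "t = \<tau> \<sigma>\<theta> \<sigma>\<epsilon>"
  have "\<bar>posterior_reward \<theta> \<sigma>\<theta> \<sigma>\<epsilon> (ramp p \<delta>) x - ramp p \<delta> x\<bar>
      \<le> \<bar>(t * x + (1 - t) * \<theta>) - x\<bar> + posterior_sd \<sigma>\<theta> \<sigma>\<epsilon>"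
    unfolding posterior_reward_def posterior_def t_def[symmetric]
    using reward_program_ramp[OF less_imp_le[OF p], of \<delta>]
    by (intro abs_integral_normal_diff_le[OF posterior_sd_pos[OF pos], where B = p])
       (auto simp: reward_program_def ramp_lipschitz)
  also have "(t * x + (1 - t) * \<theta>) - x = (1 - t) * (\<theta> - x)"
    by (simp add: algebra_simps)
  also have "\<bar>(1 - t) * (\<theta> - x)\<bar> = \<sigma>\<epsilon>\<^sup>2 / (total_sd \<sigma>\<theta> \<sigma>\<epsilon>)\<^sup>2 * \<bar>x - \<theta>\<bar>"
    unfolding t_def one_minus_posterior_weight[OF pos(2)] abs_mult by (simp add: abs_minus_commute)
  finally show ?thesis
    using posterior_sd_le[OF pos] by linarith
qed

text \<open>
  The shift \<open>\<delta>\<close> of the ramp exceeds the error of replacing \<open>E[r | v\<^sub>i = x]\<close> by \<open>r x\<close> on \<open>[0, p]\<close>,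
  which forces the cutoff to satisfy \<open>c \<le> \<delta>\<close>; below \<open>\<delta>\<close> the ramp refunds the full price, so nothing
  is lost on the consumers who do not buy.
\<close>

lemma expected_profit_ramp_ge:
  assumes pos: "\<sigma>\<theta> > 0" "\<sigma>\<epsilon> > 0" and p: "p > 0"
    and \<sigma>: "\<sigma> = total_sd \<sigma>\<theta> \<sigma>\<epsilon>"
    and \<delta>: "\<delta> = \<sigma>\<epsilon>\<^sup>2 / \<sigma>\<^sup>2 * (p + \<bar>\<theta>\<bar>) + 2 * \<sigma>\<epsilon>"
    and c: "0 \<le> c" "c \<le> p" and f: "feasible_RC \<theta> \<sigma>\<theta> \<sigma>\<epsilon> p (ramp p \<delta>) c"
  shows "expected_profit \<theta> \<sigma>\<theta> \<sigma>\<epsilon> p (ramp p \<delta>) c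
    \<ge> profit_bound \<theta> \<sigma> p - \<delta> - (\<sigma>\<epsilon>\<^sup>2 / \<sigma> + \<sigma>\<epsilon>)"
proof -
  define k where "k = \<sigma>\<epsilon>\<^sup>2 / \<sigma>\<^sup>2"
  have k: "k \<ge> 0" by (simp add: k_def)
  have \<sigma>_pos: "\<sigma> > 0" by (simp add: \<sigma> total_sd_pos pos)
  have \<delta>_nonneg: "\<delta> \<ge> 0" using k p pos by (simp add: \<delta> k_def[symmetric])
  have r: "reward_program p (ramp p \<delta>)"
    by (rule reward_program_ramp) (use p in simp)
  have rb[measurable]: "ramp p \<delta> \<in> borel_measurable borel"
    using r by (simp add: reward_program_def)
  note [measurable] = borel_measurable_posterior_reward[OF pos rb, of \<theta>]
  note bd = posterior_reward_bounds[OF pos r, of \<theta>]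
  note err = posterior_reward_ramp_error[OF pos p, of \<theta> \<delta>, folded \<sigma>, folded k_def]
  interpret prob_space "normal_distribution \<theta> \<sigma>"
    by (rule prob_space_normal_distribution) fact
  have "c \<le> \<delta>"
  proof (rule ccontr)
    \<comment> \<open>The cutoff equation would force an error of at least \<delta> at
      \<open>c\<close>, while the error is at most
      \<open>k * (p + \<bar>\<theta>\<bar>) + \<sigma>\<epsilon>\<close>. The second
      \<open>\<sigma>\<epsilon>\<close> in \<delta> makes this a strict contradiction.\<close>
    assume "\<not> c \<le> \<delta>"
    then have "ramp p \<delta> c + c - p \<ge> \<delta>" by (simp add: ramp_def)
    moreover have "c + posterior_reward \<theta> \<sigma>\<theta> \<sigma>\<epsilon> (ramp p \<delta>) c = p"
      using f by (simp add: feasible_RC_def)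
    moreover have "k * \<bar>c - \<theta>\<bar> \<le> k * (p + \<bar>\<theta>\<bar>)"
      using k c by (intro mult_left_mono) auto
    ultimately show False
      using err[of c] pos(2) by (simp add: \<delta> k_def[symmetric])
  qed
  have le: "max 0 (min p x) - (\<delta> + \<sigma>\<epsilon> + k * \<bar>x - \<theta>\<bar>)
      \<le> indicator {c..} x * (p - posterior_reward \<theta> \<sigma>\<theta> \<sigma>\<epsilon> (ramp p \<delta>) x)" for x
  proof -
    have nn: "0 \<le> k * \<bar>x - \<theta>\<bar>" using k by simp
    \<comment> \<open>The margin \<open>p - ramp p \<delta> x\<close> is \<open>x - \<delta>\<close>
      clipped to \<open>[0, p]\<close>, and clipping moves by at most the shift \<delta>.\<close>
    have ramp_le: "max 0 (min p x) - \<delta> \<le> p - ramp p \<delta> x"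
      using \<delta>_nonneg p by (auto simp: ramp_def)
    show ?thesis
    proof (cases "x \<ge> c")
      case True
      then show ?thesis using err[of x] ramp_le by simp
    next
      case False
      \<comment> \<open>Here \<open>x < c \<le> \<delta>\<close>, so the clipped signal is at most
        \<delta> and the left side is at most 0.\<close>
      then show ?thesis using nn \<open>c \<le> \<delta>\<close> \<delta>_nonneg pos(2) by (auto simp: max_def min_def)
    qed
  qed
  have int_abs: "integrable (normal_distribution \<theta> \<sigma>) (\<lambda>x. \<bar>x - \<theta>\<bar>)"
    by (rule integrable_normal_abs_diff[OF \<sigma>_pos])
  have int_U: "integrable (normal_distribution \<theta> \<sigma>) (\<lambda>x. max 0 (min p x))"
    using p by (intro integrable_normal_distribution_bounded[OF \<sigma>_pos, where B = p]) auto
  have "(\<integral>x. \<bar>x - \<theta>\<bar> \<partial>normal_distribution \<theta> \<sigma>) \<le> \<sigma>"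
    using integral_normal_abs_diff_le[OF \<sigma>_pos, of \<theta> \<theta>] by simp
  then have "k * (\<integral>x. \<bar>x - \<theta>\<bar> \<partial>normal_distribution \<theta> \<sigma>) \<le> k * \<sigma>"
    using k by (rule mult_left_mono)
  also have "k * \<sigma> = \<sigma>\<epsilon>\<^sup>2 / \<sigma>" using \<sigma>_pos by (simp add: k_def power2_eq_square)
  finally have "profit_bound \<theta> \<sigma> p - \<delta> - (\<sigma>\<epsilon>\<^sup>2 / \<sigma> + \<sigma>\<epsilon>)
      \<le> profit_bound \<theta> \<sigma> p - (\<delta> + \<sigma>\<epsilon> + k * (\<integral>x. \<bar>x - \<theta>\<bar> \<partial>normal_distribution \<theta> \<sigma>))"
    by simp
  also have "\<dots> = (\<integral>x. max 0 (min p x) - (\<delta> + \<sigma>\<epsilon> + k * \<bar>x - \<theta>\<bar>) \<partial>normal_distribution \<theta> \<sigma>)"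
    using int_abs int_U prob_space by (simp add: profit_bound_def)
  also have "\<dots> \<le> (\<integral>x. indicator {c..} x * (p - posterior_reward \<theta> \<sigma>\<theta> \<sigma>\<epsilon> (ramp p \<delta>) x)
      \<partial>normal_distribution \<theta> \<sigma>)"
  proof (rule integral_mono[OF _ _ le])
    show "integrable (normal_distribution \<theta> \<sigma>)
        (\<lambda>x. max 0 (min p x) - (\<delta> + \<sigma>\<epsilon> + k * \<bar>x - \<theta>\<bar>))"
      using int_abs int_U by auto
    show "integrable (normal_distribution \<theta> \<sigma>)
        (\<lambda>x. indicator {c..} x * (p - posterior_reward \<theta> \<sigma>\<theta> \<sigma>\<epsilon> (ramp p \<delta>) x))"
      using bd p by (intro integrable_normal_distribution_bounded[OF \<sigma>_pos, where B = p])
         (auto simp: indicator_def)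
  qed
  also have "\<dots> = expected_profit \<theta> \<sigma>\<theta> \<sigma>\<epsilon> p (ramp p \<delta>) c"
    by (simp add: expected_profit_eq[OF pos r] \<sigma>)
  finally show ?thesis .
qed

section \<open>Comparison of the optimal profits and the limit of vanishing noise\<close>

lemma optimal_RC_profit_bounds:
  assumes pos: "\<sigma>\<theta> > 0" "\<sigma>\<epsilon> > 0" and p: "p > 0" and \<sigma>: "\<sigma> = total_sd \<sigma>\<theta> \<sigma>\<epsilon>"
    and RC: "optimal_RC \<theta> \<sigma>\<theta> \<sigma>\<epsilon> p r' c'" and opt: "optimal \<theta> \<sigma>\<theta> \<sigma>\<epsilon> p r c"
  shows "profit_bound \<theta> \<sigma> p - (\<sigma>\<epsilon>\<^sup>2 / \<sigma>\<^sup>2 * (p + \<bar>\<theta>\<bar>) + \<sigma>\<epsilon>\<^sup>2 / \<sigma> + 3 * \<sigma>\<epsilon>)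
      \<le> expected_profit \<theta> \<sigma>\<theta> \<sigma>\<epsilon> p r' c'"
    and "expected_profit \<theta> \<sigma>\<theta> \<sigma>\<epsilon> p r' c' \<le> expected_profit \<theta> \<sigma>\<theta> \<sigma>\<epsilon> p r c"
    and "expected_profit \<theta> \<sigma>\<theta> \<sigma>\<epsilon> p r c \<le> profit_bound \<theta> \<sigma> p"
proof -
  have RC': "feasible_RC \<theta> \<sigma>\<theta> \<sigma>\<epsilon> p r' c'"
    "\<And>s d. feasible_RC \<theta> \<sigma>\<theta> \<sigma>\<epsilon> p s d \<Longrightarrow>
      expected_profit \<theta> \<sigma>\<theta> \<sigma>\<epsilon> p s d \<le> expected_profit \<theta> \<sigma>\<theta> \<sigma>\<epsilon> p r' c'"
    using RC by (auto simp: optimal_RC_def is_arg_max_linorder)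
  have opt': "feasible \<theta> \<sigma>\<theta> \<sigma>\<epsilon> p r c"
    "\<And>s d. feasible \<theta> \<sigma>\<theta> \<sigma>\<epsilon> p s d \<Longrightarrow>
      expected_profit \<theta> \<sigma>\<theta> \<sigma>\<epsilon> p s d \<le> expected_profit \<theta> \<sigma>\<theta> \<sigma>\<epsilon> p r c"
    using opt by (auto simp: optimal_def is_arg_max_linorder)
  show "expected_profit \<theta> \<sigma>\<theta> \<sigma>\<epsilon> p r' c' \<le> expected_profit \<theta> \<sigma>\<theta> \<sigma>\<epsilon> p r c"
    by (intro opt'(2) feasible_RC_imp_feasible pos RC'(1))
  show "expected_profit \<theta> \<sigma>\<theta> \<sigma>\<epsilon> p r c \<le> profit_bound \<theta> \<sigma> p"
    using expected_profit_le[OF pos opt'(1)] by (simp add: \<sigma>)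
  define \<delta> where "\<delta> = \<sigma>\<epsilon>\<^sup>2 / \<sigma>\<^sup>2 * (p + \<bar>\<theta>\<bar>) + 2 * \<sigma>\<epsilon>"
  obtain d where d: "0 \<le> d" "d \<le> p" "feasible_RC \<theta> \<sigma>\<theta> \<sigma>\<epsilon> p (ramp p \<delta>) d"
    using feasible_RC_ramp[OF pos p] by blast
  \<comment> \<open>The total loss is \<delta>, which contains
    \<open>2 * \<sigma>\<epsilon>\<close>, plus the averaged error
    \<open>\<sigma>\<epsilon>\<^sup>2 / \<sigma> + \<sigma>\<epsilon>\<close>; hence the
    \<open>3 * \<sigma>\<epsilon>\<close>.\<close>
  from expected_profit_ramp_ge[OF pos p \<sigma> \<delta>_def d] RC'(2)[OF d(3)]
  show "profit_bound \<theta> \<sigma> p - (\<sigma>\<epsilon>\<^sup>2 / \<sigma>\<^sup>2 * (p + \<bar>\<theta>\<bar>) + \<sigma>\<epsilon>\<^sup>2 / \<sigma> + 3 * \<sigma>\<epsilon>)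
      \<le> expected_profit \<theta> \<sigma>\<theta> \<sigma>\<epsilon> p r' c'"
    by (simp add: \<delta>_def)
qed

text \<open>With \<sigma> fixed, \<open>\<sigma>\<theta>\<close> varies with
  \<open>\<sigma>\<epsilon>\<close> and is therefore a function, and
  \<open>\<sigma>\<theta> \<sigma>\<epsilon> > 0\<close> is possible only for
  \<open>\<sigma>\<epsilon> < \<sigma>\<close>. The ratio is squeezed between
  \<open>(U - e s) / U\<close> and 1, where \<open>U\<close> does not change along the
  limit.\<close>

lemma RC_asymptotically_optimal:
  fixes \<sigma>\<theta> :: "real \<Rightarrow> real"
  assumes \<sigma>: "\<sigma> > 0" and p: "p > 0"
    and H: "\<And>\<sigma>\<epsilon>. 0 < \<sigma>\<epsilon> \<Longrightarrow> \<sigma>\<epsilon> < \<sigma> \<Longrightarrow>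
      \<sigma>\<theta> \<sigma>\<epsilon> > 0 \<and> \<sigma> = total_sd (\<sigma>\<theta> \<sigma>\<epsilon>) \<sigma>\<epsilon> \<and>
      optimal_RC \<theta> (\<sigma>\<theta> \<sigma>\<epsilon>) \<sigma>\<epsilon> p (r' \<sigma>\<epsilon>) (c' \<sigma>\<epsilon>) \<and>
      optimal \<theta> (\<sigma>\<theta> \<sigma>\<epsilon>) \<sigma>\<epsilon> p (r \<sigma>\<epsilon>) (c \<sigma>\<epsilon>)"
  shows "((\<lambda>\<sigma>\<epsilon>. expected_profit \<theta> (\<sigma>\<theta> \<sigma>\<epsilon>) \<sigma>\<epsilon> p (r' \<sigma>\<epsilon>) (c' \<sigma>\<epsilon>) /
      expected_profit \<theta> (\<sigma>\<theta> \<sigma>\<epsilon>) \<sigma>\<epsilon> p (r \<sigma>\<epsilon>) (c \<sigma>\<epsilon>)) \<longlongrightarrow> 1) (at_right 0)"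
proof -
  define U where "U = profit_bound \<theta> \<sigma> p"
  define e where "e = (\<lambda>\<sigma>\<epsilon>. \<sigma>\<epsilon>\<^sup>2 / \<sigma>\<^sup>2 * (p + \<bar>\<theta>\<bar>) + \<sigma>\<epsilon>\<^sup>2 / \<sigma> + 3 * \<sigma>\<epsilon>)"
  have U: "U > 0" unfolding U_def by (rule profit_bound_pos[OF \<sigma> p])
  have "(e \<longlongrightarrow> 0\<^sup>2 / \<sigma>\<^sup>2 * (p + \<bar>\<theta>\<bar>) + 0\<^sup>2 / \<sigma> + 3 * 0) (at_right 0)"
    unfolding e_def by (intro tendsto_intros) (use \<sigma> in auto)
  then have e: "(e \<longlongrightarrow> 0) (at_right 0)" by simp
  have ev: "\<forall>\<^sub>F s in at_right 0. 0 < s \<and> s < \<sigma> \<and> e s < U"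
    using order_tendstoD(2)[OF e U] \<sigma>
    by (intro eventually_conj) (auto simp: eventually_at_right_less eventually_at_right_field)
  have bounds: "(U - e s) / U \<le> expected_profit \<theta> (\<sigma>\<theta> s) s p (r' s) (c' s) /
        expected_profit \<theta> (\<sigma>\<theta> s) s p (r s) (c s)
      \<and> expected_profit \<theta> (\<sigma>\<theta> s) s p (r' s) (c' s) /
        expected_profit \<theta> (\<sigma>\<theta> s) s p (r s) (c s) \<le> 1"
    if s: "0 < s \<and> s < \<sigma> \<and> e s < U" for s
  proof -
    \<comment> \<open>This makes both profits positive, so the quotient is a genuine one and
      \<open>frac_le\<close> applies.\<close>
    have *: "0 < U - e s" using s by simp
    have "U - e s \<le> expected_profit \<theta> (\<sigma>\<theta> s) s p (r' s) (c' s)"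
      "expected_profit \<theta> (\<sigma>\<theta> s) s p (r' s) (c' s) \<le> expected_profit \<theta> (\<sigma>\<theta> s) s p (r s) (c s)"
      "expected_profit \<theta> (\<sigma>\<theta> s) s p (r s) (c s) \<le> U"
      using optimal_RC_profit_bounds[of "\<sigma>\<theta> s" s p \<sigma> \<theta> "r' s" "c' s" "r s" "c s"] H[of s] s p
      unfolding U_def e_def by blast+
    with * show ?thesis
      by (intro conjI frac_le) (auto simp: divide_le_eq)
  qed
  have "((\<lambda>s. (U - e s) / U) \<longlongrightarrow> (U - 0) / U) (at_right 0)"
    by (intro tendsto_intros e) (use U in auto)
  then have "((\<lambda>s. (U - e s) / U) \<longlongrightarrow> 1) (at_right 0)" using U by simp
  then show ?thesis
  proof (rule tendsto_sandwich[rotated 2])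
    show "((\<lambda>_. 1) \<longlongrightarrow> 1) (at_right (0::real))" by simp
  qed (use ev bounds in \<open>auto elim!: eventually_mono\<close>)
qed

theorem theorem5:
  fixes \<theta> \<sigma> p :: real
  assumes "\<sigma> > 0" and "market_price \<theta> \<sigma> p"
  shows
    "(\<forall>\<sigma>\<theta> \<sigma>\<epsilon>. \<sigma>\<theta> > 0 \<longrightarrow> \<sigma>\<epsilon> > 0 \<longrightarrow> \<sigma> = total_sd \<sigma>\<theta> \<sigma>\<epsilon> \<longrightarrow>
        \<sigma>\<epsilon> / \<sigma>\<theta> \<ge> p / (sqrt (2 * pi) * \<sigma>) \<longrightarrow>
        (\<forall>r\<^sub>S\<^sub>C c\<^sub>S\<^sub>C. optimal_SC \<theta> \<sigma>\<theta> \<sigma>\<epsilon> p r\<^sub>S\<^sub>C c\<^sub>S\<^sub>C \<longleftrightarrow> optimal \<theta> \<sigma>\<theta> \<sigma>\<epsilon> p r\<^sub>S\<^sub>C c\<^sub>S\<^sub>C)) \<and>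
     (\<forall>(\<sigma>\<theta> :: real \<Rightarrow> real) r\<^sub>R\<^sub>C c\<^sub>R\<^sub>C r c.
        (\<forall>\<sigma>\<epsilon>. 0 < \<sigma>\<epsilon> \<and> \<sigma>\<epsilon> < \<sigma> \<longrightarrow>
           \<sigma>\<theta> \<sigma>\<epsilon> > 0 \<and> \<sigma> = total_sd (\<sigma>\<theta> \<sigma>\<epsilon>) \<sigma>\<epsilon> \<and>
           optimal_RC \<theta> (\<sigma>\<theta> \<sigma>\<epsilon>) \<sigma>\<epsilon> p (r\<^sub>R\<^sub>C \<sigma>\<epsilon>) (c\<^sub>R\<^sub>C \<sigma>\<epsilon>) \<and>
           optimal \<theta> (\<sigma>\<theta> \<sigma>\<epsilon>) \<sigma>\<epsilon> p (r \<sigma>\<epsilon>) (c \<sigma>\<epsilon>)) \<longrightarrow>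
        ((\<lambda>\<sigma>\<epsilon>. expected_profit \<theta> (\<sigma>\<theta> \<sigma>\<epsilon>) \<sigma>\<epsilon> p (r\<^sub>R\<^sub>C \<sigma>\<epsilon>) (c\<^sub>R\<^sub>C \<sigma>\<epsilon>) /
                expected_profit \<theta> (\<sigma>\<theta> \<sigma>\<epsilon>) \<sigma>\<epsilon> p (r \<sigma>\<epsilon>) (c \<sigma>\<epsilon>)) \<longlongrightarrow> 1) (at_right 0))"
proof (intro conjI allI impI)
  fix \<sigma>\<theta> \<sigma>\<epsilon> r\<^sub>S\<^sub>C c\<^sub>S\<^sub>C
  assume "\<sigma>\<theta> > 0" "\<sigma>\<epsilon> > 0" "\<sigma> = total_sd \<sigma>\<theta> \<sigma>\<epsilon>" "\<sigma>\<epsilon> / \<sigma>\<theta> \<ge> p / (sqrt (2 * pi) * \<sigma>)"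
  \<comment> \<open>The two constraints coincide for all programs and cutoffs at once, so the
    maximization problems are identical.\<close>
  then have "feasible_SC \<theta> \<sigma>\<theta> \<sigma>\<epsilon> p = feasible \<theta> \<sigma>\<theta> \<sigma>\<epsilon> p"
    using feasible_SC_iff_feasible by blast
  then show "optimal_SC \<theta> \<sigma>\<theta> \<sigma>\<epsilon> p r\<^sub>S\<^sub>C c\<^sub>S\<^sub>C \<longleftrightarrow> optimal \<theta> \<sigma>\<theta> \<sigma>\<epsilon> p r\<^sub>S\<^sub>C c\<^sub>S\<^sub>C"
    by (simp add: optimal_SC_def optimal_def)
next
  fix \<sigma>\<theta> :: "real \<Rightarrow> real" and r\<^sub>R\<^sub>C c\<^sub>R\<^sub>C r c
  assume H: "\<forall>\<sigma>\<epsilon>. 0 < \<sigma>\<epsilon> \<and> \<sigma>\<epsilon> < \<sigma> \<longrightarrow>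
    \<sigma>\<theta> \<sigma>\<epsilon> > 0 \<and> \<sigma> = total_sd (\<sigma>\<theta> \<sigma>\<epsilon>) \<sigma>\<epsilon> \<and>
    optimal_RC \<theta> (\<sigma>\<theta> \<sigma>\<epsilon>) \<sigma>\<epsilon> p (r\<^sub>R\<^sub>C \<sigma>\<epsilon>) (c\<^sub>R\<^sub>C \<sigma>\<epsilon>) \<and>
    optimal \<theta> (\<sigma>\<theta> \<sigma>\<epsilon>) \<sigma>\<epsilon> p (r \<sigma>\<epsilon>) (c \<sigma>\<epsilon>)"
  have "p > 0"
    using assms(2) by (simp add: market_price_def is_arg_max_def)
  from RC_asymptotically_optimal[OF assms(1) this] H
  show "((\<lambda>\<sigma>\<epsilon>. expected_profit \<theta> (\<sigma>\<theta> \<sigma>\<epsilon>) \<sigma>\<epsilon> p (r\<^sub>R\<^sub>C \<sigma>\<epsilon>) (c\<^sub>R\<^sub>C \<sigma>\<epsilon>) /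
      expected_profit \<theta> (\<sigma>\<theta> \<sigma>\<epsilon>) \<sigma>\<epsilon> p (r \<sigma>\<epsilon>) (c \<sigma>\<epsilon>)) \<longlongrightarrow> 1) (at_right 0)"
    by blast
qed

end
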